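(* Let $\mathcal E$ be an essentially small idempotent-complete exact category with enough projective objects. The full subcategory $$\operatorname{Fddell}(\mathcal E)=\{X\in\mathcal E\mid\operatorname{ddell}_{\mathcal E}X<\infty\}$$ is admissibly torsion-free. With the exact structure induced from $\mathcal E$, it is a resolving exact subcategory with enough projective objects. If $\mathcal E$ is a length abelian category (with its standard exact structure), then $\operatorname{Fddell}(\mathcal E)$ is a torsion-free class.
   Context: A full subcategory $\mathcal F\subseteq\mathcal E$ is admissibly torsion-free if it is closed under isomorphisms, direct summands, extensions and admissible subobjects (i.e. $X\rightarrowtail Y$ an inflation with $Y\in\mathcal F$ implies $X\in\mathcal F$). A full subcategory is resolving if it contains the projective objects of $\mathcal E$ and is closed under extensions, direct summands and kernels of deflations between its objects. In a length abelian category a torsion-free class is a full subcategory closed under isomorphisms, extensions and subobjects. Short exact sequences of the exact structure are called conflations, their first maps inflations and second maps deflations. For each $X\in\mathcal E$ fix a conflation $0\to\Omega_{\mathcal E}X\to P_X\to X\to0$ with $P_X$ projective. The stable category $\underline{\mathcal E}=\mathcal E/[\operatorname{Proj}\mathcal E]$ has morphisms modulo those factoring through projectives, and $\Omega_{\mathcal E}$ is an endofunctor of it. $X$ is a stable retract of $Y$ if there are $u:X\to Y$, $v:Y\to X$ in $\underline{\mathcal E}$ with $vu=1_X$. For $k\ge1$, $$k\text{-}\operatorname{dell}_{\mathcal E}X=\inf\{n\ge0\mid \Omega_{\mathcal E}^nX\text{ is a stable retract of }\Omega_{\mathcal E}^{n+k}Y\text{ for some }Y\in\mathcal E\}.$$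 A sequence $0\to C_t\to\cdots\to C_0\to X\to0$ is admissibly exact if there are objects $Z_0=X,Z_1,\dots,Z_t=C_t$ and conflations $0\to Z_{i+1}\to C_i\to Z_i\to0$ for $0\le i<t$ from which it is spliced (for $t=0$: $C_0\to X$ is an isomorphism). $k\text{-}\operatorname{ddell}_{\mathcal E}X$ is the infimum of the integers $m\ge0$ such that there are $0\le t\le m$ and an admissibly exact sequence $0\to C_t\to\cdots\to C_0\to X\to0$ with $(i+k)\text{-}\operatorname{dell}_{\mathcal E}C_i\le m-i$ for $0\le i\le t$. ($\inf\emptyset=\infty$.) $\operatorname{ddell}_{\mathcal E}$ means $1\text{-}\operatorname{ddell}_{\mathcal E}$. *)

theory Defs
  imports Main "HOL-Library.Extended_Nat" "HOL-Algebra.Coset"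
begin

text \<open>
  Categories are records carrying a set of objects and a set of arrows inside arbitrary HOL types,
  so that every category below is small.  Composition is written in applicative order.
\<close>

record ('o, 'm) cat =
  Obj :: "'o set"
  Arr :: "'m set"
  Dom :: "'m \<Rightarrow> 'o"
  Cod :: "'m \<Rightarrow> 'o"
  Ident :: "'o \<Rightarrow> 'm"
  Comp :: "'m \<Rightarrow> 'm \<Rightarrow> 'm" (infixl "\<cdot>\<index>" 70)

definition Hom :: "('o, 'm, 'z) cat_scheme \<Rightarrow> 'o \<Rightarrow> 'o \<Rightarrow> 'm set" where
  "Hom C X Y = {f \<in> Arr C. Dom C f = X \<and> Cod C f = Y}"

locale category =
  fixes C :: "('o, 'm, 'z) cat_scheme" (structure)
  assumes Dom_in_Obj: "f \<in> Arr C \<Longrightarrow> Dom C f \<in> Obj C"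
    and Cod_in_Obj: "f \<in> Arr C \<Longrightarrow> Cod C f \<in> Obj C"
    and Ident_in_Hom: "X \<in> Obj C \<Longrightarrow> Ident C X \<in> Hom C X X"
    and Comp_in_Hom: "\<lbrakk>f \<in> Hom C X Y; g \<in> Hom C Y Z\<rbrakk> \<Longrightarrow> g \<cdot> f \<in> Hom C X Z"
    and Comp_assoc: "\<lbrakk>f \<in> Hom C W X; g \<in> Hom C X Y; h \<in> Hom C Y Z\<rbrakk> \<Longrightarrow> h \<cdot> g \<cdot> f = h \<cdot> (g \<cdot> f)"
    and Comp_Ident_right: "f \<in> Hom C X Y \<Longrightarrow> f \<cdot> Ident C X = f"
    and Comp_Ident_left: "f \<in> Hom C X Y \<Longrightarrow> Ident C Y \<cdot> f = f"

definition is_iso :: "('o, 'm, 'z) cat_scheme \<Rightarrow> 'm \<Rightarrow> bool" where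
  "is_iso C f \<longleftrightarrow> f \<in> Arr C \<and>
     (\<exists>g \<in> Hom C (Cod C f) (Dom C f).
        g \<cdot>\<^bsub>C\<^esub> f = Ident C (Dom C f) \<and> f \<cdot>\<^bsub>C\<^esub> g = Ident C (Cod C f))"

definition isomorphic :: "('o, 'm, 'z) cat_scheme \<Rightarrow> 'o \<Rightarrow> 'o \<Rightarrow> bool" where
  "isomorphic C X Y \<longleftrightarrow> (\<exists>f \<in> Hom C X Y. is_iso C f)"

definition is_mono :: "('o, 'm, 'z) cat_scheme \<Rightarrow> 'm \<Rightarrow> bool" where
  "is_mono C f \<longleftrightarrow> f \<in> Arr C \<and>
     (\<forall>T. \<forall>g \<in> Hom C T (Dom C f). \<forall>h \<in> Hom C T (Dom C f). f \<cdot>\<^bsub>C\<^esub> g = f \<cdot>\<^bsub>C\<^esub> h \<longrightarrow> g = h)"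

definition is_epi :: "('o, 'm, 'z) cat_scheme \<Rightarrow> 'm \<Rightarrow> bool" where
  "is_epi C f \<longleftrightarrow> f \<in> Arr C \<and>
     (\<forall>T. \<forall>g \<in> Hom C (Cod C f) T. \<forall>h \<in> Hom C (Cod C f) T. g \<cdot>\<^bsub>C\<^esub> f = h \<cdot>\<^bsub>C\<^esub> f \<longrightarrow> g = h)"

definition is_retract :: "('o, 'm, 'z) cat_scheme \<Rightarrow> 'o \<Rightarrow> 'o \<Rightarrow> bool" where
  "is_retract C X Y \<longleftrightarrow> (\<exists>u \<in> Hom C X Y. \<exists>v \<in> Hom C Y X. v \<cdot>\<^bsub>C\<^esub> u = Ident C X)"

definition is_zero_object :: "('o, 'm, 'z) cat_scheme \<Rightarrow> 'o \<Rightarrow> bool" where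
  "is_zero_object C Z \<longleftrightarrow> Z \<in> Obj C \<and>
     (\<forall>X \<in> Obj C. (\<exists>!f. f \<in> Hom C Z X) \<and> (\<exists>!f. f \<in> Hom C X Z))"

definition idempotent_complete :: "('o, 'm, 'z) cat_scheme \<Rightarrow> bool" where
  "idempotent_complete C \<longleftrightarrow>
     (\<forall>X \<in> Obj C. \<forall>e \<in> Hom C X X. e \<cdot>\<^bsub>C\<^esub> e = e \<longrightarrow>
        (\<exists>Y \<in> Obj C. \<exists>r \<in> Hom C X Y. \<exists>s \<in> Hom C Y X.
           s \<cdot>\<^bsub>C\<^esub> r = e \<and> r \<cdot>\<^bsub>C\<^esub> s = Ident C Y))"

definition is_pullback :: "('o, 'm, 'z) cat_scheme \<Rightarrow> 'm \<Rightarrow> 'm \<Rightarrow> 'm \<Rightarrow> 'm \<Rightarrow> bool" where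
  \<comment> \<open>\<open>p'\<close> is the base change of \<open>p\<close> along \<open>f\<close>\<close>
  "is_pullback C p f p' f' \<longleftrightarrow>
     p \<in> Arr C \<and> f \<in> Arr C \<and> Cod C p = Cod C f \<and>
     p' \<in> Hom C (Dom C f') (Dom C f) \<and> f' \<in> Hom C (Dom C p') (Dom C p) \<and>
     p \<cdot>\<^bsub>C\<^esub> f' = f \<cdot>\<^bsub>C\<^esub> p' \<and>
     (\<forall>T. \<forall>a \<in> Hom C T (Dom C p). \<forall>b \<in> Hom C T (Dom C f). p \<cdot>\<^bsub>C\<^esub> a = f \<cdot>\<^bsub>C\<^esub> b \<longrightarrow>
        (\<exists>!c. c \<in> Hom C T (Dom C p') \<and> f' \<cdot>\<^bsub>C\<^esub> c = a \<and> p' \<cdot>\<^bsub>C\<^esub> c = b))"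

definition is_pushout :: "('o, 'm, 'z) cat_scheme \<Rightarrow> 'm \<Rightarrow> 'm \<Rightarrow> 'm \<Rightarrow> 'm \<Rightarrow> bool" where
  \<comment> \<open>\<open>i'\<close> is the cobase change of \<open>i\<close> along \<open>f\<close>\<close>
  "is_pushout C i f i' f' \<longleftrightarrow>
     i \<in> Arr C \<and> f \<in> Arr C \<and> Dom C i = Dom C f \<and>
     i' \<in> Hom C (Cod C f) (Cod C f') \<and> f' \<in> Hom C (Cod C i) (Cod C i') \<and>
     f' \<cdot>\<^bsub>C\<^esub> i = i' \<cdot>\<^bsub>C\<^esub> f \<and>
     (\<forall>T. \<forall>a \<in> Hom C (Cod C i) T. \<forall>b \<in> Hom C (Cod C f) T. a \<cdot>\<^bsub>C\<^esub> i = b \<cdot>\<^bsub>C\<^esub> f \<longrightarrow>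
        (\<exists>!c. c \<in> Hom C (Cod C i') T \<and> c \<cdot>\<^bsub>C\<^esub> f' = a \<and> c \<cdot>\<^bsub>C\<^esub> i' = b))"


subsection \<open>Additive categories\<close>

record ('o, 'm) add_cat = "('o, 'm) cat" +
  hom_add :: "'m \<Rightarrow> 'm \<Rightarrow> 'm"
  hom_zero :: "'o \<Rightarrow> 'o \<Rightarrow> 'm"

definition hom_group :: "('o, 'm, 'z) add_cat_scheme \<Rightarrow> 'o \<Rightarrow> 'o \<Rightarrow> 'm monoid" where
  "hom_group C X Y = \<lparr>carrier = Hom C X Y, monoid.mult = hom_add C, one = hom_zero C X Y\<rparr>"

locale preadditive_category = category C
  for C :: "('o, 'm, 'z) add_cat_scheme" (structure) +
  assumes hom_comm_group: "\<lbrakk>X \<in> Obj C; Y \<in> Obj C\<rbrakk> \<Longrightarrow> comm_group (hom_group C X Y)"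
    and Comp_add_right: "\<lbrakk>f \<in> Hom C X Y; f' \<in> Hom C X Y; g \<in> Hom C Y Z\<rbrakk> \<Longrightarrow>
      g \<cdot> hom_add C f f' = hom_add C (g \<cdot> f) (g \<cdot> f')"
    and Comp_add_left: "\<lbrakk>f \<in> Hom C X Y; g \<in> Hom C Y Z; g' \<in> Hom C Y Z\<rbrakk> \<Longrightarrow>
      hom_add C g g' \<cdot> f = hom_add C (g \<cdot> f) (g' \<cdot> f)"

definition is_biproduct :: "('o, 'm, 'z) add_cat_scheme \<Rightarrow> 'o \<Rightarrow> 'o \<Rightarrow> 'o \<Rightarrow> bool" where
  "is_biproduct C A B S \<longleftrightarrow>
     (\<exists>i\<^sub>1 \<in> Hom C A S. \<exists>i\<^sub>2 \<in> Hom C B S. \<exists>p\<^sub>1 \<in> Hom C S A. \<exists>p\<^sub>2 \<in> Hom C S B.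
        p\<^sub>1 \<cdot>\<^bsub>C\<^esub> i\<^sub>1 = Ident C A \<and> p\<^sub>2 \<cdot>\<^bsub>C\<^esub> i\<^sub>2 = Ident C B \<and>
        p\<^sub>1 \<cdot>\<^bsub>C\<^esub> i\<^sub>2 = hom_zero C B A \<and> p\<^sub>2 \<cdot>\<^bsub>C\<^esub> i\<^sub>1 = hom_zero C A B \<and>
        hom_add C (i\<^sub>1 \<cdot>\<^bsub>C\<^esub> p\<^sub>1) (i\<^sub>2 \<cdot>\<^bsub>C\<^esub> p\<^sub>2) = Ident C S)"

definition direct_summand :: "('o, 'm, 'z) add_cat_scheme \<Rightarrow> 'o \<Rightarrow> 'o \<Rightarrow> bool" where
  "direct_summand C X Y \<longleftrightarrow> X \<in> Obj C \<and> Y \<in> Obj C \<and> (\<exists>X' \<in> Obj C. is_biproduct C X X' Y)"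

locale additive_category = preadditive_category C
  for C :: "('o, 'm, 'z) add_cat_scheme" (structure) +
  assumes zero_object_exists: "\<exists>Z. is_zero_object C Z"
    and biproduct_exists: "\<lbrakk>A \<in> Obj C; B \<in> Obj C\<rbrakk> \<Longrightarrow> \<exists>S \<in> Obj C. is_biproduct C A B S"

definition is_kernel :: "('o, 'm, 'z) add_cat_scheme \<Rightarrow> 'm \<Rightarrow> 'm \<Rightarrow> bool" where
  \<comment> \<open>\<open>i\<close> is a kernel of \<open>p\<close>\<close>
  "is_kernel C i p \<longleftrightarrow> i \<in> Arr C \<and> p \<in> Arr C \<and> Cod C i = Dom C p \<and>
     p \<cdot>\<^bsub>C\<^esub> i = hom_zero C (Dom C i) (Cod C p) \<and>
     (\<forall>T. \<forall>h \<in> Hom C T (Dom C p). p \<cdot>\<^bsub>C\<^esub> h = hom_zero C T (Cod C p) \<longrightarrow>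
        (\<exists>!k. k \<in> Hom C T (Dom C i) \<and> i \<cdot>\<^bsub>C\<^esub> k = h))"

definition is_cokernel :: "('o, 'm, 'z) add_cat_scheme \<Rightarrow> 'm \<Rightarrow> 'm \<Rightarrow> bool" where
  \<comment> \<open>\<open>p\<close> is a cokernel of \<open>i\<close>\<close>
  "is_cokernel C p i \<longleftrightarrow> i \<in> Arr C \<and> p \<in> Arr C \<and> Cod C i = Dom C p \<and>
     p \<cdot>\<^bsub>C\<^esub> i = hom_zero C (Dom C i) (Cod C p) \<and>
     (\<forall>T. \<forall>h \<in> Hom C (Cod C i) T. h \<cdot>\<^bsub>C\<^esub> i = hom_zero C (Dom C i) T \<longrightarrow>
        (\<exists>!k. k \<in> Hom C (Cod C p) T \<and> k \<cdot>\<^bsub>C\<^esub> p = h))"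

definition kernel_cokernel_pair :: "('o, 'm, 'z) add_cat_scheme \<Rightarrow> 'm \<Rightarrow> 'm \<Rightarrow> bool" where
  "kernel_cokernel_pair C i p \<longleftrightarrow> is_kernel C i p \<and> is_cokernel C p i"


subsection \<open>Exact categories\<close>

text \<open>A conflation is stored as the pair of its inflation and its deflation.\<close>

record ('o, 'm) exact_cat = "('o, 'm) add_cat" +
  Confl :: "('m \<times> 'm) set"

definition inflation :: "('o, 'm, 'z) exact_cat_scheme \<Rightarrow> 'm \<Rightarrow> bool" where
  "inflation E i \<longleftrightarrow> (\<exists>p. (i, p) \<in> Confl E)"

definition deflation :: "('o, 'm, 'z) exact_cat_scheme \<Rightarrow> 'm \<Rightarrow> bool" where
  "deflation E p \<longleftrightarrow> (\<exists>i. (i, p) \<in> Confl E)"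

text \<open>Quillen's axioms, in the form given by Buehler.\<close>

locale exact_category = additive_category E
  for E :: "('o, 'm, 'z) exact_cat_scheme" (structure) +
  assumes Confl_kernel_cokernel: "(i, p) \<in> Confl E \<Longrightarrow> kernel_cokernel_pair E i p"
    and Confl_iso: "\<lbrakk>(i, p) \<in> Confl E; i' \<in> Hom E A' B'; p' \<in> Hom E B' C';
        a \<in> Hom E (Dom E i) A'; b \<in> Hom E (Cod E i) B'; c \<in> Hom E (Cod E p) C';
        is_iso E a; is_iso E b; is_iso E c; b \<cdot> i = i' \<cdot> a; c \<cdot> p = p' \<cdot> b\<rbrakk> \<Longrightarrow>
      (i', p') \<in> Confl E"
    and inflation_Ident: "X \<in> Obj E \<Longrightarrow> inflation E (Ident E X)"
    and deflation_Ident: "X \<in> Obj E \<Longrightarrow> deflation E (Ident E X)"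
    and inflation_Comp: "\<lbrakk>inflation E i; inflation E j; Cod E i = Dom E j\<rbrakk> \<Longrightarrow> inflation E (j \<cdot> i)"
    and deflation_Comp: "\<lbrakk>deflation E p; deflation E q; Cod E p = Dom E q\<rbrakk> \<Longrightarrow> deflation E (q \<cdot> p)"
    and inflation_pushout: "\<lbrakk>inflation E i; f \<in> Arr E; Dom E f = Dom E i\<rbrakk> \<Longrightarrow>
      \<exists>i' f'. is_pushout E i f i' f' \<and> inflation E i'"
    and deflation_pullback: "\<lbrakk>deflation E p; f \<in> Arr E; Cod E f = Cod E p\<rbrakk> \<Longrightarrow>
      \<exists>p' f'. is_pullback E p f p' f' \<and> deflation E p'"

definition projective :: "('o, 'm, 'z) exact_cat_scheme \<Rightarrow> 'o \<Rightarrow> bool" where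
  "projective E P \<longleftrightarrow> P \<in> Obj E \<and>
     (\<forall>p f. deflation E p \<and> f \<in> Hom E P (Cod E p) \<longrightarrow>
        (\<exists>g \<in> Hom E P (Dom E p). p \<cdot>\<^bsub>E\<^esub> g = f))"

definition enough_projectives :: "('o, 'm, 'z) exact_cat_scheme \<Rightarrow> bool" where
  "enough_projectives E \<longleftrightarrow>
     (\<forall>X \<in> Obj E. \<exists>p. deflation E p \<and> Cod E p = X \<and> projective E (Dom E p))"

definition full_exact_subcategory ::
    "('o, 'm, 'z) exact_cat_scheme \<Rightarrow> 'o set \<Rightarrow> ('o, 'm, 'z) exact_cat_scheme" where
  \<comment> \<open>the full subcategory on \<open>F\<close>, with the conflations of \<open>E\<close> all of whose terms lie in \<open>F\<close>\<close>
  "full_exact_subcategory E F = E\<lparr>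
     Obj := F,
     Arr := {f \<in> Arr E. Dom E f \<in> F \<and> Cod E f \<in> F},
     Confl := {(i, p) \<in> Confl E. Dom E i \<in> F \<and> Cod E i \<in> F \<and> Cod E p \<in> F}\<rparr>"


subsection \<open>The stable category and syzygies\<close>

definition proj_ideal :: "('o, 'm, 'z) exact_cat_scheme \<Rightarrow> 'o \<Rightarrow> 'o \<Rightarrow> 'm set" where
  "proj_ideal E X Y = {f \<in> Hom E X Y.
     \<exists>P. projective E P \<and> (\<exists>g \<in> Hom E X P. \<exists>h \<in> Hom E P Y. f = h \<cdot>\<^bsub>E\<^esub> g)}"

definition stable_class :: "('o, 'm, 'z) exact_cat_scheme \<Rightarrow> 'm \<Rightarrow> 'm set" where
  "stable_class E f =
     proj_ideal E (Dom E f) (Cod E f) #>\<^bsub>hom_group E (Dom E f) (Cod E f)\<^esub> f"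

text \<open>
  The arrows of the stable category are the cosets of the subgroups of arrows factoring through a
  projective object.  All members of a coset are parallel, so it determines its domain and codomain,
  and the union in the definition of composition is over equal cosets.
\<close>

definition stable_category :: "('o, 'm, 'z) exact_cat_scheme \<Rightarrow> ('o, 'm set) cat" where
  "stable_category E = \<lparr>
     Obj = Obj E,
     Arr = stable_class E ` Arr E,
     Dom = (\<lambda>c. THE X. \<exists>f \<in> c. Dom E f = X),
     Cod = (\<lambda>c. THE Y. \<exists>f \<in> c. Cod E f = Y),
     Ident = (\<lambda>X. stable_class E (Ident E X)),
     Comp = (\<lambda>d c. \<Union>g \<in> d. \<Union>f \<in> c. stable_class E (g \<cdot>\<^bsub>E\<^esub> f))\<rparr>"

definition stable_retract :: "('o, 'm, 'z) exact_cat_scheme \<Rightarrow> 'o \<Rightarrow> 'o \<Rightarrow> bool" where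
  "stable_retract E X Y \<longleftrightarrow> is_retract (stable_category E) X Y"

text \<open>
  A choice, for every object \<open>X\<close>, of a conflation with middle term projective and right-hand term
  \<open>X\<close>; its left-hand term is the syzygy of \<open>X\<close>.
\<close>

definition syzygy_choice :: "('o, 'm, 'z) exact_cat_scheme \<Rightarrow> ('o \<Rightarrow> 'm \<times> 'm) \<Rightarrow> bool" where
  "syzygy_choice E S \<longleftrightarrow>
     (\<forall>X \<in> Obj E. S X \<in> Confl E \<and> projective E (Dom E (snd (S X))) \<and> Cod E (snd (S X)) = X)"

definition syzygy :: "('o, 'm, 'z) exact_cat_scheme \<Rightarrow> ('o \<Rightarrow> 'm \<times> 'm) \<Rightarrow> 'o \<Rightarrow> 'o" where
  "syzygy E S X = Dom E (fst (S X))"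


subsection \<open>Delooping levels\<close>

text \<open>Infima are taken in \<^typ>\<open>enat\<close>, where the infimum of the empty set is \<open>\<infinity>\<close>.\<close>

definition dell ::
    "('o, 'm, 'z) exact_cat_scheme \<Rightarrow> ('o \<Rightarrow> 'm \<times> 'm) \<Rightarrow> nat \<Rightarrow> 'o \<Rightarrow> enat" where
  "dell E S k X = Inf {enat n | n.
     \<exists>Y \<in> Obj E. stable_retract E ((syzygy E S ^^ n) X) ((syzygy E S ^^ (n + k)) Y)}"

definition admissibly_exact ::
    "('o, 'm, 'z) exact_cat_scheme \<Rightarrow> nat \<Rightarrow> (nat \<Rightarrow> 'o) \<Rightarrow> (nat \<Rightarrow> 'm) \<Rightarrow> 'o \<Rightarrow> bool" where
  \<comment> \<open>the sequence has terms \<open>C 0, \<dots>, C t\<close> and \<open>X\<close>; its maps are \<open>d 0\<close> from \<open>C 0\<close> to \<open>X\<close> and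
      \<open>d i\<close> from \<open>C i\<close> to \<open>C (i - 1)\<close>\<close>
  "admissibly_exact E t C d X \<longleftrightarrow>
     (if t = 0 then d 0 \<in> Hom E (C 0) X \<and> is_iso E (d 0)
      else \<exists>Z \<iota> \<pi>. Z 0 = X \<and> Z t = C t \<and>
        (\<forall>i<t. (\<iota> i, \<pi> i) \<in> Confl E \<and> \<iota> i \<in> Hom E (Z (Suc i)) (C i) \<and> \<pi> i \<in> Hom E (C i) (Z i)) \<and>
        d 0 = \<pi> 0 \<and> (\<forall>i. Suc i < t \<longrightarrow> d (Suc i) = \<iota> i \<cdot>\<^bsub>E\<^esub> \<pi> (Suc i)) \<and> d t = \<iota> (t - 1))"

definition ddell ::
    "('o, 'm, 'z) exact_cat_scheme \<Rightarrow> ('o \<Rightarrow> 'm \<times> 'm) \<Rightarrow> nat \<Rightarrow> 'o \<Rightarrow> enat" where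
  "ddell E S k X = Inf {enat m | m.
     \<exists>t\<le>m. \<exists>C d. admissibly_exact E t C d X \<and> (\<forall>i\<le>t. dell E S (i + k) (C i) \<le> enat (m - i))}"

definition Fddell :: "('o, 'm, 'z) exact_cat_scheme \<Rightarrow> ('o \<Rightarrow> 'm \<times> 'm) \<Rightarrow> 'o set" where
  "Fddell E S = {X \<in> Obj E. ddell E S 1 X < \<infinity>}"


subsection \<open>Classes of subcategories\<close>

text \<open>Full subcategories are given by their sets of objects.\<close>

definition closed_under_isos :: "('o, 'm, 'z) cat_scheme \<Rightarrow> 'o set \<Rightarrow> bool" where
  "closed_under_isos C F \<longleftrightarrow> (\<forall>X \<in> F. \<forall>Y \<in> Obj C. isomorphic C X Y \<longrightarrow> Y \<in> F)"

definition closed_under_summands :: "('o, 'm, 'z) add_cat_scheme \<Rightarrow> 'o set \<Rightarrow> bool" where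
  "closed_under_summands C F \<longleftrightarrow> (\<forall>Y \<in> F. \<forall>X. direct_summand C X Y \<longrightarrow> X \<in> F)"

definition closed_under_extensions :: "('o, 'm, 'z) exact_cat_scheme \<Rightarrow> 'o set \<Rightarrow> bool" where
  "closed_under_extensions E F \<longleftrightarrow>
     (\<forall>(i, p) \<in> Confl E. Dom E i \<in> F \<and> Cod E p \<in> F \<longrightarrow> Cod E i \<in> F)"

definition admissibly_torsion_free :: "('o, 'm, 'z) exact_cat_scheme \<Rightarrow> 'o set \<Rightarrow> bool" where
  "admissibly_torsion_free E F \<longleftrightarrow> F \<subseteq> Obj E \<and>
     closed_under_isos E F \<and> closed_under_summands E F \<and> closed_under_extensions E F \<and>
     (\<forall>i. inflation E i \<and> Cod E i \<in> F \<longrightarrow> Dom E i \<in> F)"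

definition resolving :: "('o, 'm, 'z) exact_cat_scheme \<Rightarrow> 'o set \<Rightarrow> bool" where
  "resolving E F \<longleftrightarrow> F \<subseteq> Obj E \<and>
     (\<forall>P. projective E P \<longrightarrow> P \<in> F) \<and>
     closed_under_extensions E F \<and> closed_under_summands E F \<and>
     (\<forall>(i, p) \<in> Confl E. Dom E p \<in> F \<and> Cod E p \<in> F \<longrightarrow> Dom E i \<in> F)"


subsection \<open>Length abelian categories\<close>

locale abelian_category = additive_category C
  for C :: "('o, 'm, 'z) add_cat_scheme" (structure) +
  assumes kernel_exists: "f \<in> Arr C \<Longrightarrow> \<exists>i. is_kernel C i f"
    and cokernel_exists: "f \<in> Arr C \<Longrightarrow> \<exists>p. is_cokernel C p f"
    and mono_is_kernel: "is_mono C f \<Longrightarrow> \<exists>p. is_kernel C f p"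
    and epi_is_cokernel: "is_epi C f \<Longrightarrow> \<exists>i. is_cokernel C f i"

definition simple_object :: "('o, 'm, 'z) cat_scheme \<Rightarrow> 'o \<Rightarrow> bool" where
  "simple_object C X \<longleftrightarrow> X \<in> Obj C \<and> \<not> is_zero_object C X \<and>
     (\<forall>f. is_mono C f \<and> Cod C f = X \<longrightarrow> is_zero_object C (Dom C f) \<or> is_iso C f)"

definition finite_length :: "('o, 'm, 'z) add_cat_scheme \<Rightarrow> 'o \<Rightarrow> bool" where
  \<comment> \<open>existence of a composition series\<close>
  "finite_length C X \<longleftrightarrow> (\<exists>n U j. is_zero_object C (U 0) \<and> U n = X \<and>
     (\<forall>l<n. j l \<in> Hom C (U l) (U (Suc l)) \<and> is_mono C (j l) \<and>
        (\<exists>q. is_cokernel C q (j l) \<and> simple_object C (Cod C q))))"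

definition length_abelian_category :: "('o, 'm, 'z) add_cat_scheme \<Rightarrow> bool" where
  "length_abelian_category C \<longleftrightarrow> abelian_category C \<and> (\<forall>X \<in> Obj C. finite_length C X)"

definition standard_exact_structure :: "('o, 'm, 'z) exact_cat_scheme \<Rightarrow> bool" where
  \<comment> \<open>in an abelian category, the kernel-cokernel pairs are the short exact sequences\<close>
  "standard_exact_structure E \<longleftrightarrow> Confl E = {(i, p). kernel_cokernel_pair E i p}"

definition torsion_free_class :: "('o, 'm, 'z) exact_cat_scheme \<Rightarrow> 'o set \<Rightarrow> bool" where
  "torsion_free_class E F \<longleftrightarrow> F \<subseteq> Obj E \<and>
     closed_under_isos E F \<and> closed_under_extensions E F \<and>
     (\<forall>f. is_mono E f \<and> Cod E f \<in> F \<longrightarrow> Dom E f \<in> F)"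

end

theory Submission
  imports Defs
begin

text \<open>
  Allowing arbitrary finite \<open>m\<close>, the definition of \<open>k\<close>-ddell unfolds into an inductive predicate
  \<open>F k\<close>: either \<open>k\<close>-dell of \<open>X\<close> is finite, or there is a conflation \<open>Z \<rightarrow> C \<rightarrow> X\<close> in which \<open>k\<close>-dell of
  \<open>C\<close> is finite and \<open>F (k + 1) Z\<close> holds.  A horseshoe argument shows that \<open>\<Omega>\<close> maps \<open>F k\<close> to
  \<open>F (k + 1)\<close>.  For a conflation \<open>A \<rightarrow> B \<rightarrow> C\<close>, pulling back along \<open>P\<^sub>C \<rightarrow> C\<close> gives
  \<open>\<Omega> C \<rightarrow> A \<oplus> P\<^sub>C \<rightarrow> B\<close>, and induction on \<open>F k A\<close> shows that \<open>F k\<close> is closed under extensions.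
  If \<open>F 1 B\<close> holds, the same conflation exhibits \<open>A \<oplus> P\<^sub>C\<close> as an extension of
  objects in \<open>F 1\<close>, because \<open>F 0\<close> holds for every object, in particular for \<open>C\<close>; the projective
  summand can then be dropped.  This is closure under admissible subobjects, and direct summands are a
  special case.
\<close>

section \<open>Preadditive categories\<close>

text \<open>The bounds m - i in the definition of ddell can be recovered from finiteness alone,
  because a resolution has only finitely many terms; hence plain finiteness at level i + k suffices.
  Finiteness of dell passes to stable retracts, but \<open>finite_ddell\<close> does not visibly do
  so, since a resolution of an object does not restrict to a retract of it. Retract arguments are
  therefore applied only where dell itself is finite, and projective summands are removed by
  composing deflations. The level k has to vary: the kernels of a resolution live one level higher,
  and so do syzygies. Because the two shifts agree, the kernel produced by the horseshoe is an
  extension of \<Omega> C by Z with both ends at level k + 1, and an induction with C generalised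
  closes.\<close>

notation hom_add (infixl "\<boxplus>\<index>" 65)

section \<open>Arrow calculus, pullbacks and pushouts\<close>

context category
begin

text \<open>Typing is carried by equations on \<open>Dom\<close> and \<open>Cod\<close> rather than
  by Hom-sets, so that the simplifier can discharge it; this rule converts between the two.\<close>

lemma in_Hom_iff: "f \<in> Hom C X Y \<longleftrightarrow> f \<in> Arr C \<and> Dom C f = X \<and> Cod C f = Y"
  by (simp add: Hom_def)

lemma Dom_Obj [simp]: "f \<in> Arr C \<Longrightarrow> Dom C f \<in> Obj C"
  and Cod_Obj [simp]: "f \<in> Arr C \<Longrightarrow> Cod C f \<in> Obj C"
  by (simp_all add: Dom_in_Obj Cod_in_Obj)

lemma Ident_simps [simp]:
  assumes "X \<in> Obj C"
  shows "Ident C X \<in> Arr C" "Dom C (Ident C X) = X" "Cod C (Ident C X) = X"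
  using Ident_in_Hom[OF assms] by (simp_all add: in_Hom_iff)

lemma Comp_simps [simp]:
  assumes "f \<in> Arr C" "g \<in> Arr C" "Cod C f = Dom C g"
  shows "g \<cdot> f \<in> Arr C" "Dom C (g \<cdot> f) = Dom C f" "Cod C (g \<cdot> f) = Cod C g"
  using Comp_in_Hom[of f "Dom C f" "Dom C g" g "Cod C g"] assms by (simp_all add: in_Hom_iff)

lemma Comp_assoc_Arr [simp]:
  assumes "f \<in> Arr C" "g \<in> Arr C" "h \<in> Arr C" "Cod C f = Dom C g" "Cod C g = Dom C h"
  shows "h \<cdot> g \<cdot> f = h \<cdot> (g \<cdot> f)"
  using Comp_assoc[of f "Dom C f" "Dom C g" g "Dom C h" h "Cod C h"] assms by (simp add: in_Hom_iff)

lemma Comp_Ident_Arr [simp]: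
  assumes "f \<in> Arr C"
  shows "Dom C f = X \<Longrightarrow> f \<cdot> Ident C X = f" "Cod C f = X \<Longrightarrow> Ident C X \<cdot> f = f"
  using Comp_Ident_right[of f] Comp_Ident_left[of f] assms by (auto simp: in_Hom_iff)

text \<open>The simp set associates composites to the right, which hides a known composite
  \<open>g \<cdot> f\<close> inside \<open>g \<cdot> (f \<cdot> h)\<close>. This rule exposes it
  there.\<close>

lemma Comp_reassoc:
  assumes "g \<cdot> f = k" "f \<in> Arr C" "g \<in> Arr C" "h \<in> Arr C" "Cod C h = Dom C f" "Cod C f = Dom C g"
  shows "g \<cdot> (f \<cdot> h) = k \<cdot> h"
  using Comp_assoc_Arr[of h f g] assms(2-) by (simp add: assms(1)[symmetric])

lemma is_isoI:
  assumes "f \<in> Hom C X Y" "g \<in> Hom C Y X" "g \<cdot> f = Ident C X" "f \<cdot> g = Ident C Y"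
  shows "is_iso C f"
  using assms by (auto simp: is_iso_def in_Hom_iff)

lemma is_iso_Ident: "X \<in> Obj C \<Longrightarrow> is_iso C (Ident C X)"
  by (rule is_isoI[of _ X X "Ident C X"]) (auto simp: in_Hom_iff)

lemma is_pullback_sym: "is_pullback C p f p' f' \<Longrightarrow> is_pullback C f p f' p'"
  unfolding is_pullback_def in_Hom_iff
  by (elim conjE, intro conjI allI ballI impI) (simp_all add: conj_commute)

lemma is_pullbackD:
  assumes "is_pullback C p f p' f'"
  shows "p \<in> Arr C" "f \<in> Arr C" "p' \<in> Arr C" "f' \<in> Arr C" "Cod C p = Cod C f"
    "Dom C p' = Dom C f'" "Cod C p' = Dom C f" "Cod C f' = Dom C p" "p \<cdot> f' = f \<cdot> p'"
  using assms unfolding is_pullback_def in_Hom_iff by blast+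

lemma is_pullback_ex1:
  assumes "is_pullback C p f p' f'" "a \<in> Arr C" "b \<in> Arr C" "Dom C a = Dom C b"
    "Cod C a = Dom C p" "Cod C b = Dom C f" "p \<cdot> a = f \<cdot> b"
  shows "\<exists>!c. c \<in> Hom C (Dom C b) (Dom C p') \<and> f' \<cdot> c = a \<and> p' \<cdot> c = b"
proof -
  have "\<forall>T. \<forall>a\<in>Hom C T (Dom C p). \<forall>b\<in>Hom C T (Dom C f). p \<cdot> a = f \<cdot> b \<longrightarrow>
      (\<exists>!c. c \<in> Hom C T (Dom C p') \<and> f' \<cdot> c = a \<and> p' \<cdot> c = b)"
    using assms(1) unfolding is_pullback_def by blast
  from this[rule_format, of a "Dom C b" b] assms(2-) show ?thesis by (simp add: in_Hom_iff)
qed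

lemma is_pullback_liftE:
  assumes "is_pullback C p f p' f'" "a \<in> Arr C" "b \<in> Arr C" "Dom C a = Dom C b"
    "Cod C a = Dom C p" "Cod C b = Dom C f" "p \<cdot> a = f \<cdot> b"
  obtains c where "c \<in> Arr C" "Dom C c = Dom C b" "Cod C c = Dom C p'" "f' \<cdot> c = a" "p' \<cdot> c = b"
  using is_pullback_ex1[OF assms] that unfolding in_Hom_iff by blast

lemma is_pullback_unique:
  assumes "is_pullback C p f p' f'" "f' \<cdot> c = f' \<cdot> d" "p' \<cdot> c = p' \<cdot> d" "c \<in> Arr C" "d \<in> Arr C"
    "Dom C c = Dom C d" "Cod C c = Dom C p'" "Cod C d = Dom C p'"
  shows "c = d"
proof -
  note P = is_pullbackD[OF assms(1)]
  have "p \<cdot> (f' \<cdot> d) = f \<cdot> (p' \<cdot> d)"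
    using P assms(4-) Comp_reassoc[OF P(9), of d] by simp
  with is_pullback_ex1[OF assms(1), of "f' \<cdot> d" "p' \<cdot> d"] P assms(4-)
  have "\<exists>!c. c \<in> Hom C (Dom C d) (Dom C p') \<and> f' \<cdot> c = f' \<cdot> d \<and> p' \<cdot> c = p' \<cdot> d" by simp
  moreover have "c \<in> Hom C (Dom C d) (Dom C p')" "d \<in> Hom C (Dom C d) (Dom C p')"
    using assms(4-) by (simp_all add: in_Hom_iff)
  ultimately show ?thesis using assms(2,3) by blast
qed

lemma is_pushoutD:
  assumes "is_pushout C i f i' f'"
  shows "i \<in> Arr C" "f \<in> Arr C" "i' \<in> Arr C" "f' \<in> Arr C" "Dom C i = Dom C f"
    "Cod C i' = Cod C f'" "Dom C i' = Cod C f" "Dom C f' = Cod C i" "f' \<cdot> i = i' \<cdot> f"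
  using assms unfolding is_pushout_def in_Hom_iff by blast+

lemma is_pushout_ex1:
  assumes "is_pushout C i f i' f'" "a \<in> Arr C" "b \<in> Arr C" "Cod C a = Cod C b"
    "Dom C a = Cod C i" "Dom C b = Cod C f" "a \<cdot> i = b \<cdot> f"
  shows "\<exists>!c. c \<in> Hom C (Cod C i') (Cod C b) \<and> c \<cdot> f' = a \<and> c \<cdot> i' = b"
proof -
  have "\<forall>T. \<forall>a\<in>Hom C (Cod C i) T. \<forall>b\<in>Hom C (Cod C f) T. a \<cdot> i = b \<cdot> f \<longrightarrow>
      (\<exists>!c. c \<in> Hom C (Cod C i') T \<and> c \<cdot> f' = a \<and> c \<cdot> i' = b)"
    using assms(1) unfolding is_pushout_def by blast
  from this[rule_format, of a "Cod C b" b] assms(2-) show ?thesis by (simp add: in_Hom_iff)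
qed

lemma is_pushout_descE:
  assumes "is_pushout C i f i' f'" "a \<in> Arr C" "b \<in> Arr C" "Cod C a = Cod C b"
    "Dom C a = Cod C i" "Dom C b = Cod C f" "a \<cdot> i = b \<cdot> f"
  obtains c where "c \<in> Arr C" "Cod C c = Cod C b" "Dom C c = Cod C i'" "c \<cdot> f' = a" "c \<cdot> i' = b"
  using is_pushout_ex1[OF assms] that unfolding in_Hom_iff by blast

lemma is_pushout_unique:
  assumes "is_pushout C i f i' f'" "c \<cdot> f' = d \<cdot> f'" "c \<cdot> i' = d \<cdot> i'" "c \<in> Arr C" "d \<in> Arr C"
    "Cod C c = Cod C d" "Dom C c = Cod C i'" "Dom C d = Cod C i'"
  shows "c = d"
proof -
  note P = is_pushoutD[OF assms(1)]
  have "d \<cdot> f' \<cdot> i = d \<cdot> i' \<cdot> f"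
    using P assms(4-) by simp
  with is_pushout_ex1[OF assms(1), of "d \<cdot> f'" "d \<cdot> i'"] P assms(4-)
  have "\<exists>!c. c \<in> Hom C (Cod C i') (Cod C d) \<and> c \<cdot> f' = d \<cdot> f' \<and> c \<cdot> i' = d \<cdot> i'" by simp
  moreover have "c \<in> Hom C (Cod C i') (Cod C d)" "d \<in> Hom C (Cod C i') (Cod C d)"
    using assms(4-) by (simp_all add: in_Hom_iff)
  ultimately show ?thesis using assms(2,3) by blast
qed

end

text \<open>The hom group is read off from the arrow itself, so negation needs no object
  arguments.\<close>

definition hom_neg :: "('o, 'm, 'z) add_cat_scheme \<Rightarrow> 'm \<Rightarrow> 'm" where
  "hom_neg C f = inv\<^bsub>hom_group C (Dom C f) (Cod C f)\<^esub> f"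

context preadditive_category
begin

lemma hom_group_simps [simp]:
  "carrier (hom_group C X Y) = Hom C X Y"
  "monoid.mult (hom_group C X Y) = hom_add C"
  "one (hom_group C X Y) = hom_zero C X Y"
  by (simp_all add: hom_group_def)

lemma hom_zero_simps [simp]:
  assumes "X \<in> Obj C" "Y \<in> Obj C"
  shows "hom_zero C X Y \<in> Arr C" "Dom C (hom_zero C X Y) = X" "Cod C (hom_zero C X Y) = Y"
proof -
  interpret comm_group "hom_group C X Y" using assms by (rule hom_comm_group)
  show "hom_zero C X Y \<in> Arr C" "Dom C (hom_zero C X Y) = X" "Cod C (hom_zero C X Y) = Y"
    using one_closed by (simp_all add: in_Hom_iff)
qed

lemma hom_add_simps [simp]:
  assumes "f \<in> Arr C" "g \<in> Arr C" "Dom C f = Dom C g" "Cod C f = Cod C g"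
  shows "f \<boxplus> g \<in> Arr C" "Dom C (f \<boxplus> g) = Dom C g" "Cod C (f \<boxplus> g) = Cod C g"
proof -
  interpret comm_group "hom_group C (Dom C g) (Cod C g)" using assms by (intro hom_comm_group) auto
  show "f \<boxplus> g \<in> Arr C" "Dom C (f \<boxplus> g) = Dom C g" "Cod C (f \<boxplus> g) = Cod C g"
    using m_closed[of f g] assms by (simp_all add: in_Hom_iff)
qed

lemma hom_neg_simps [simp]:
  assumes "f \<in> Arr C"
  shows "hom_neg C f \<in> Arr C" "Dom C (hom_neg C f) = Dom C f" "Cod C (hom_neg C f) = Cod C f"
    "f \<boxplus> hom_neg C f = hom_zero C (Dom C f) (Cod C f)"
    "hom_neg C f \<boxplus> f = hom_zero C (Dom C f) (Cod C f)"
proof -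
  interpret comm_group "hom_group C (Dom C f) (Cod C f)" using assms by (intro hom_comm_group) auto
  show "hom_neg C f \<in> Arr C" "Dom C (hom_neg C f) = Dom C f" "Cod C (hom_neg C f) = Cod C f"
    "f \<boxplus> hom_neg C f = hom_zero C (Dom C f) (Cod C f)"
    "hom_neg C f \<boxplus> f = hom_zero C (Dom C f) (Cod C f)"
    using inv_closed[of f] r_inv[of f] l_inv[of f] assms by (simp_all add: hom_neg_def in_Hom_iff)
qed

lemma hom_add_assoc:
  assumes "f \<in> Arr C" "g \<in> Arr C" "h \<in> Arr C" "Dom C f = Dom C g" "Cod C f = Cod C g"
    "Dom C g = Dom C h" "Cod C g = Cod C h"
  shows "f \<boxplus> g \<boxplus> h = f \<boxplus> (g \<boxplus> h)"
proof -
  interpret comm_group "hom_group C (Dom C h) (Cod C h)" using assms by (intro hom_comm_group) auto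
  show ?thesis using m_assoc[of f g h] assms by (simp add: in_Hom_iff)
qed

lemma hom_add_commute:
  assumes "f \<in> Arr C" "g \<in> Arr C" "Dom C f = Dom C g" "Cod C f = Cod C g"
  shows "f \<boxplus> g = g \<boxplus> f"
proof -
  interpret comm_group "hom_group C (Dom C g) (Cod C g)" using assms by (intro hom_comm_group) auto
  show ?thesis using m_comm[of f g] assms by (simp add: in_Hom_iff)
qed

lemma hom_add_zero [simp]:
  assumes "f \<in> Arr C" "Dom C f = X" "Cod C f = Y"
  shows "f \<boxplus> hom_zero C X Y = f" "hom_zero C X Y \<boxplus> f = f"
proof -
  interpret comm_group "hom_group C X Y" using assms by (intro hom_comm_group) auto
  show "f \<boxplus> hom_zero C X Y = f" "hom_zero C X Y \<boxplus> f = f"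
    using r_one[of f] l_one[of f] assms by (simp_all add: in_Hom_iff)
qed

lemma hom_add_left_cancel:
  assumes "f \<boxplus> g = f \<boxplus> h" "f \<in> Arr C" "g \<in> Arr C" "h \<in> Arr C" "Dom C f = Dom C g"
    "Cod C f = Cod C g" "Dom C f = Dom C h" "Cod C f = Cod C h"
  shows "g = h"
proof -
  have *: "hom_neg C f \<boxplus> (f \<boxplus> x) = x"
    if "x \<in> Arr C" "Dom C f = Dom C x" "Cod C f = Cod C x" for x
  proof -
    have "hom_neg C f \<boxplus> (f \<boxplus> x) = hom_neg C f \<boxplus> f \<boxplus> x"
      using that assms(2) by (intro hom_add_assoc[symmetric]) simp_all
    also have "\<dots> = x" using that assms(2) by simp
    finally show ?thesis .
  qed
  show ?thesis using *[of g] *[of h] assms by metis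
qed

lemma Comp_hom_add [simp]:
  assumes "f \<in> Arr C" "g \<in> Arr C" "h \<in> Arr C" "Dom C f = Dom C g" "Cod C f = Cod C g"
  shows "Cod C g = Dom C h \<Longrightarrow> h \<cdot> (f \<boxplus> g) = h \<cdot> f \<boxplus> h \<cdot> g"
    "Dom C g = Cod C h \<Longrightarrow> (f \<boxplus> g) \<cdot> h = f \<cdot> h \<boxplus> g \<cdot> h"
  using Comp_add_right[of f "Dom C g" "Cod C g" g h "Cod C h"]
    Comp_add_left[of h "Dom C h" "Dom C g" f "Cod C g" g] assms by (auto simp: in_Hom_iff)

lemma Comp_hom_zero [simp]:
  assumes "f \<in> Arr C" "X \<in> Obj C"
  shows "Dom C f = Y \<Longrightarrow> f \<cdot> hom_zero C X Y = hom_zero C X (Cod C f)"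
    "Cod C f = Y \<Longrightarrow> hom_zero C Y X \<cdot> f = hom_zero C (Dom C f) X"
proof -
  show "f \<cdot> hom_zero C X Y = hom_zero C X (Cod C f)" if "Dom C f = Y"
  proof -
    let ?z = "hom_zero C X Y"
    have Y: "Y \<in> Obj C" using that assms by auto
    \<comment> \<open>The sum 0 + 0 is distributed before it is simplified, hence the removal of
      \<open>hom_add_zero\<close>. The composite added to itself equals itself, so cancellation
      makes it zero.\<close>
    have "f \<cdot> ?z \<boxplus> f \<cdot> ?z = f \<cdot> (?z \<boxplus> ?z)"
      using assms that Y by (simp del: hom_add_zero)
    also have "\<dots> = f \<cdot> ?z \<boxplus> hom_zero C X (Cod C f)" using assms that Y by simp
    finally show ?thesis by (rule hom_add_left_cancel) (use assms that Y in simp_all)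
  qed
  show "hom_zero C Y X \<cdot> f = hom_zero C (Dom C f) X" if "Cod C f = Y"
  proof -
    let ?z = "hom_zero C Y X"
    have Y: "Y \<in> Obj C" using that assms by auto
    have "?z \<cdot> f \<boxplus> ?z \<cdot> f = (?z \<boxplus> ?z) \<cdot> f"
      using assms that Y by (simp del: hom_add_zero)
    also have "\<dots> = ?z \<cdot> f \<boxplus> hom_zero C (Dom C f) X" using assms that Y by simp
    finally show ?thesis by (rule hom_add_left_cancel) (use assms that Y in simp_all)
  qed
qed

lemma Comp_hom_neg [simp]:
  assumes "f \<in> Arr C" "g \<in> Arr C" "Cod C f = Dom C g"
  shows "g \<cdot> hom_neg C f = hom_neg C (g \<cdot> f)" "hom_neg C g \<cdot> f = hom_neg C (g \<cdot> f)"
proof -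
  have "g \<cdot> f \<boxplus> g \<cdot> hom_neg C f = g \<cdot> f \<boxplus> hom_neg C (g \<cdot> f)"
    using assms Comp_hom_add(1)[of f "hom_neg C f" g, symmetric] by simp
  then show "g \<cdot> hom_neg C f = hom_neg C (g \<cdot> f)"
    by (rule hom_add_left_cancel) (use assms in simp_all)
  have "g \<cdot> f \<boxplus> hom_neg C g \<cdot> f = g \<cdot> f \<boxplus> hom_neg C (g \<cdot> f)"
    using assms Comp_hom_add(2)[of g "hom_neg C g" f, symmetric] by simp
  then show "hom_neg C g \<cdot> f = hom_neg C (g \<cdot> f)"
    by (rule hom_add_left_cancel) (use assms in simp_all)
qed

lemma zero_object_Hom:
  assumes "is_zero_object C Z"
  shows "f \<in> Hom C Z X \<Longrightarrow> f = hom_zero C Z X" "f \<in> Hom C X Z \<Longrightarrow> f = hom_zero C X Z"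
proof -
  have Z: "Z \<in> Obj C" using assms by (simp add: is_zero_object_def)
  show "f = hom_zero C Z X" if "f \<in> Hom C Z X"
    using assms that Z unfolding is_zero_object_def in_Hom_iff
    by (metis Cod_Obj hom_zero_simps)
  show "f = hom_zero C X Z" if "f \<in> Hom C X Z"
    using assms that Z unfolding is_zero_object_def in_Hom_iff
    by (metis Dom_Obj hom_zero_simps)
qed

end

section \<open>Exact categories\<close>

context preadditive_category
begin

lemma is_kernelD:
  assumes "is_kernel C i p"
  shows "i \<in> Arr C" "p \<in> Arr C" "Cod C i = Dom C p" "p \<cdot> i = hom_zero C (Dom C i) (Cod C p)"
  using assms by (simp_all add: is_kernel_def)

lemma is_kernel_ex1:
  assumes "is_kernel C i p" "h \<in> Arr C" "Cod C h = Dom C p" "p \<cdot> h = hom_zero C (Dom C h) (Cod C p)"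
  shows "\<exists>!k. k \<in> Hom C (Dom C h) (Dom C i) \<and> i \<cdot> k = h"
  using assms unfolding is_kernel_def by (auto simp: in_Hom_iff)

lemma is_kernel_liftE:
  assumes "is_kernel C i p" "h \<in> Arr C" "Cod C h = Dom C p" "p \<cdot> h = hom_zero C (Dom C h) (Cod C p)"
  obtains k where "k \<in> Arr C" "Dom C k = Dom C h" "Cod C k = Dom C i" "i \<cdot> k = h"
  using is_kernel_ex1[OF assms] that by (auto simp: in_Hom_iff)

lemma is_kernel_cancel:
  assumes "is_kernel C i p" "i \<cdot> h = i \<cdot> k" "h \<in> Arr C" "k \<in> Arr C" "Dom C h = Dom C k"
    "Cod C h = Dom C i" "Cod C k = Dom C i"
  shows "h = k"
proof -
  note K = is_kernelD[OF assms(1)]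
  have "p \<cdot> (i \<cdot> k) = hom_zero C (Dom C k) (Cod C p)"
    using K assms(3-) Comp_reassoc[OF K(4), of k] by simp
  with is_kernel_ex1[OF assms(1), of "i \<cdot> k"] K assms(3-)
  have "\<exists>!x. x \<in> Hom C (Dom C k) (Dom C i) \<and> i \<cdot> x = i \<cdot> k" by simp
  then show ?thesis using assms(2-) by (auto simp: in_Hom_iff)
qed

lemma is_kernelI:
  assumes "i \<in> Arr C" "p \<in> Arr C" "Cod C i = Dom C p" "p \<cdot> i = hom_zero C (Dom C i) (Cod C p)"
    and "\<And>h. \<lbrakk>h \<in> Arr C; Cod C h = Dom C p; p \<cdot> h = hom_zero C (Dom C h) (Cod C p)\<rbrakk> \<Longrightarrow>
      \<exists>k. k \<in> Arr C \<and> Dom C k = Dom C h \<and> Cod C k = Dom C i \<and> i \<cdot> k = h"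
    and "\<And>h k. \<lbrakk>i \<cdot> h = i \<cdot> k; h \<in> Arr C; k \<in> Arr C; Dom C h = Dom C k;
      Cod C h = Dom C i; Cod C k = Dom C i\<rbrakk> \<Longrightarrow> h = k"
  shows "is_kernel C i p"
  unfolding is_kernel_def
proof (intro conjI allI ballI impI)
  fix T h assume h: "h \<in> Hom C T (Dom C p)" "p \<cdot> h = hom_zero C T (Cod C p)"
  then obtain k where k: "k \<in> Arr C" "Dom C k = T" "Cod C k = Dom C i" "i \<cdot> k = h"
    using assms(5)[of h] by (auto simp: in_Hom_iff)
  show "\<exists>!k. k \<in> Hom C T (Dom C i) \<and> i \<cdot> k = h"
  proof (rule ex1I[of _ k])
    fix l assume "l \<in> Hom C T (Dom C i) \<and> i \<cdot> l = h"
    then show "l = k" using k by (auto simp: in_Hom_iff intro!: assms(6)[of l k])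
  qed (use k in \<open>simp add: in_Hom_iff\<close>)
qed (rule assms)+

lemma is_cokernelD:
  assumes "is_cokernel C p i"
  shows "i \<in> Arr C" "p \<in> Arr C" "Cod C i = Dom C p" "p \<cdot> i = hom_zero C (Dom C i) (Cod C p)"
  using assms by (simp_all add: is_cokernel_def)

lemma is_cokernel_ex1:
  assumes "is_cokernel C p i" "h \<in> Arr C" "Dom C h = Cod C i" "h \<cdot> i = hom_zero C (Dom C i) (Cod C h)"
  shows "\<exists>!k. k \<in> Hom C (Cod C p) (Cod C h) \<and> k \<cdot> p = h"
  using assms unfolding is_cokernel_def by (auto simp: in_Hom_iff)

lemma is_cokernel_descE:
  assumes "is_cokernel C p i" "h \<in> Arr C" "Dom C h = Cod C i" "h \<cdot> i = hom_zero C (Dom C i) (Cod C h)"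
  obtains k where "k \<in> Arr C" "Dom C k = Cod C p" "Cod C k = Cod C h" "k \<cdot> p = h"
  using is_cokernel_ex1[OF assms] that by (auto simp: in_Hom_iff)

lemma is_cokernel_cancel:
  assumes "is_cokernel C p i" "h \<cdot> p = k \<cdot> p" "h \<in> Arr C" "k \<in> Arr C" "Cod C h = Cod C k"
    "Dom C h = Cod C p" "Dom C k = Cod C p"
  shows "h = k"
proof -
  note K = is_cokernelD[OF assms(1)]
  have "k \<cdot> p \<cdot> i = hom_zero C (Dom C i) (Cod C k)"
    using K assms(3-) by simp
  with is_cokernel_ex1[OF assms(1), of "k \<cdot> p"] K assms(3-)
  have "\<exists>!x. x \<in> Hom C (Cod C p) (Cod C k) \<and> x \<cdot> p = k \<cdot> p" by simp
  then show ?thesis using assms(2-) by (auto simp: in_Hom_iff)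
qed

lemma is_cokernelI:
  assumes "i \<in> Arr C" "p \<in> Arr C" "Cod C i = Dom C p" "p \<cdot> i = hom_zero C (Dom C i) (Cod C p)"
    and "\<And>h. \<lbrakk>h \<in> Arr C; Dom C h = Cod C i; h \<cdot> i = hom_zero C (Dom C i) (Cod C h)\<rbrakk> \<Longrightarrow>
      \<exists>k. k \<in> Arr C \<and> Dom C k = Cod C p \<and> Cod C k = Cod C h \<and> k \<cdot> p = h"
    and "\<And>h k. \<lbrakk>h \<cdot> p = k \<cdot> p; h \<in> Arr C; k \<in> Arr C; Cod C h = Cod C k;
      Dom C h = Cod C p; Dom C k = Cod C p\<rbrakk> \<Longrightarrow> h = k"
  shows "is_cokernel C p i"
  unfolding is_cokernel_def
proof (intro conjI allI ballI impI)
  fix T h assume h: "h \<in> Hom C (Cod C i) T" "h \<cdot> i = hom_zero C (Dom C i) T"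
  then obtain k where k: "k \<in> Arr C" "Dom C k = Cod C p" "Cod C k = T" "k \<cdot> p = h"
    using assms(5)[of h] by (auto simp: in_Hom_iff)
  show "\<exists>!k. k \<in> Hom C (Cod C p) T \<and> k \<cdot> p = h"
  proof (rule ex1I[of _ k])
    fix l assume "l \<in> Hom C (Cod C p) T \<and> l \<cdot> p = h"
    then show "l = k" using k by (auto simp: in_Hom_iff intro!: assms(6)[of l k])
  qed (use k in \<open>simp add: in_Hom_iff\<close>)
qed (rule assms)+

end

section \<open>Uniqueness and base change of conflations\<close>

context exact_category
begin

lemma Confl_kernel: "(i, p) \<in> Confl E \<Longrightarrow> is_kernel E i p"
  and Confl_cokernel: "(i, p) \<in> Confl E \<Longrightarrow> is_cokernel E p i"
  using Confl_kernel_cokernel by (auto simp: kernel_cokernel_pair_def)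

lemmas Confl_simps = is_kernelD[OF Confl_kernel]
  and Confl_kernelE = is_kernel_liftE[OF Confl_kernel]
  and Confl_cokernelE = is_cokernel_descE[OF Confl_cokernel]
  and Confl_mono = is_kernel_cancel[OF Confl_kernel]
  and Confl_epi = is_cokernel_cancel[OF Confl_cokernel]

text \<open>Two kernels of \<open>p\<close> differ by an isomorphism, and \<open>Confl_iso\<close>
  carries the given conflation along it. Later constructions thus need only a deflation and some
  kernel of it.\<close>

lemma deflation_kernel_Confl:
  assumes "deflation E p" "is_kernel E i p"
  shows "(i, p) \<in> Confl E"
proof -
  obtain j where j: "(j, p) \<in> Confl E" using assms(1) by (auto simp: deflation_def)
  note C = Confl_simps[OF j]
  have i: "i \<in> Arr E" "Cod E i = Dom E p" "p \<cdot> i = hom_zero E (Dom E i) (Cod E p)"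
    using assms(2) by (simp_all add: is_kernel_def)
  obtain k where k: "k \<in> Arr E" "Dom E k = Dom E i" "Cod E k = Dom E j" "j \<cdot> k = i"
    using Confl_kernelE[OF j i] by metis
  obtain l where l: "l \<in> Arr E" "Dom E l = Dom E j" "Cod E l = Dom E i" "i \<cdot> l = j"
    using is_kernel_liftE[OF assms(2) C(1,3,4)] by metis
  have "j \<cdot> (k \<cdot> l) = j \<cdot> Ident E (Dom E j)"
    using C k l by (simp add: Comp_reassoc[OF k(4)])
  then have kl: "k \<cdot> l = Ident E (Dom E j)"
    by (rule Confl_mono[OF j]) (use C k l in simp_all)
  have "i \<cdot> (l \<cdot> k) = i \<cdot> Ident E (Dom E i)"
    using C k l i by (simp add: Comp_reassoc[OF l(4)])
  then have lk: "l \<cdot> k = Ident E (Dom E i)"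
    by (rule is_kernel_cancel[OF assms(2)]) (use i k l in simp_all)
  show ?thesis
  proof (rule Confl_iso[OF j, where a = l and b = "Ident E (Cod E j)" and c = "Ident E (Cod E p)"])
    show "is_iso E l" using kl lk k l by (intro is_isoI[of l "Dom E j" "Dom E i" k]) (simp_all add: in_Hom_iff)
  qed (use C i k l in \<open>simp_all add: in_Hom_iff is_iso_Ident\<close>)
qed

text \<open>Dually, cokernels of \<open>i\<close> are unique up to the isomorphism
  \<open>k\<close>.\<close>

lemma inflation_cokernel_Confl:
  assumes "inflation E i" "is_cokernel E p i"
  shows "(i, p) \<in> Confl E"
proof -
  obtain q where q: "(i, q) \<in> Confl E" using assms(1) by (auto simp: inflation_def)
  note C = Confl_simps[OF q]
  have p: "p \<in> Arr E" "Dom E p = Cod E i" "p \<cdot> i = hom_zero E (Dom E i) (Cod E p)"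
    using assms(2) by (simp_all add: is_cokernel_def)
  obtain k where k: "k \<in> Arr E" "Dom E k = Cod E q" "Cod E k = Cod E p" "k \<cdot> q = p"
    using Confl_cokernelE[OF q p] by metis
  obtain l where l: "l \<in> Arr E" "Dom E l = Cod E p" "Cod E l = Cod E q" "l \<cdot> p = q"
    using is_cokernel_descE[OF assms(2) C(2) _ C(4)] C by metis
  have "l \<cdot> k \<cdot> q = Ident E (Cod E q) \<cdot> q"
    using C k l by simp
  then have lk: "l \<cdot> k = Ident E (Cod E q)"
    by (rule Confl_epi[OF q]) (use C k l in simp_all)
  have "k \<cdot> l \<cdot> p = Ident E (Cod E p) \<cdot> p"
    using C k l p by simp
  then have kl: "k \<cdot> l = Ident E (Cod E p)"
    by (rule is_cokernel_cancel[OF assms(2)]) (use p k l in simp_all)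
  show ?thesis
  proof (rule Confl_iso[OF q, where a = "Ident E (Dom E i)" and b = "Ident E (Cod E i)" and c = k])
    show "is_iso E k" using kl lk k l by (intro is_isoI[of k "Cod E q" "Cod E p" l]) (simp_all add: in_Hom_iff)
  qed (use C p k l in \<open>simp_all add: in_Hom_iff is_iso_Ident\<close>)
qed

lemma deflation_iso_Comp:
  assumes "deflation E p" "c \<in> Hom E X (Dom E p)" "is_iso E c"
  shows "deflation E (p \<cdot> c)"
proof -
  obtain i where i: "(i, p) \<in> Confl E" using assms(1) by (auto simp: deflation_def)
  note C = Confl_simps[OF i]
  have c: "c \<in> Arr E" "Dom E c = X" "Cod E c = Dom E p" using assms(2) by (auto simp: in_Hom_iff)
  obtain d where d: "d \<in> Arr E" "Dom E d = Dom E p" "Cod E d = X" "d \<cdot> c = Ident E X"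
    "c \<cdot> d = Ident E (Dom E p)"
    using assms(3) c by (auto simp: is_iso_def in_Hom_iff)
  have "(d \<cdot> i, p \<cdot> c) \<in> Confl E"
  proof (rule Confl_iso[OF i, where a = "Ident E (Dom E i)" and b = d and c = "Ident E (Cod E p)"])
    show "is_iso E d" using c d by (intro is_isoI[of d _ _ c]) (simp_all add: in_Hom_iff)
    show "Ident E (Cod E p) \<cdot> p = p \<cdot> c \<cdot> d" using C c d by simp
  qed (use C c d in \<open>simp_all add: in_Hom_iff is_iso_Ident\<close>)
  then show ?thesis by (auto simp: deflation_def)
qed

lemma iso_inflation_Comp:
  assumes "inflation E i" "c \<in> Hom E (Cod E i) X" "is_iso E c"
  shows "inflation E (c \<cdot> i)"
proof -
  obtain p where p: "(i, p) \<in> Confl E" using assms(1) by (auto simp: inflation_def)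
  note C = Confl_simps[OF p]
  have c: "c \<in> Arr E" "Dom E c = Cod E i" "Cod E c = X" using assms(2) by (auto simp: in_Hom_iff)
  obtain d where d: "d \<in> Arr E" "Dom E d = X" "Cod E d = Cod E i" "d \<cdot> c = Ident E (Cod E i)"
    "c \<cdot> d = Ident E X"
    using assms(3) c by (auto simp: is_iso_def in_Hom_iff)
  have "(c \<cdot> i, p \<cdot> d) \<in> Confl E"
  proof (rule Confl_iso[OF p, where a = "Ident E (Dom E i)" and b = c and c = "Ident E (Cod E p)"])
    show "is_iso E c" by fact
    show "Ident E (Cod E p) \<cdot> p = p \<cdot> d \<cdot> c" using C c d by simp
  qed (use C c d in \<open>simp_all add: in_Hom_iff is_iso_Ident\<close>)
  then show ?thesis by (auto simp: inflation_def)
qed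

text \<open>The axiom yields one pullback whose base change is a deflation. Any other pullback is
  isomorphic to it, and precomposition with an isomorphism preserves deflations.\<close>

lemma pullback_deflation:
  assumes "is_pullback E p f p' f'" "deflation E p"
  shows "deflation E p'"
proof -
  note P = is_pullbackD[OF assms(1)]
  obtain q' g' where q: "is_pullback E p f q' g'" "deflation E q'"
    using deflation_pullback[OF assms(2), of f] P by auto
  note Q = is_pullbackD[OF q(1)]
  obtain c where c: "c \<in> Arr E" "Dom E c = Dom E p'" "Cod E c = Dom E q'" "g' \<cdot> c = f'" "q' \<cdot> c = p'"
    using is_pullback_liftE[OF q(1), of f' p'] P by metis
  obtain d where d: "d \<in> Arr E" "Dom E d = Dom E q'" "Cod E d = Dom E p'" "f' \<cdot> d = g'" "p' \<cdot> d = q'"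
    using is_pullback_liftE[OF assms(1), of g' q'] Q by metis
  have "d \<cdot> c = Ident E (Dom E p')"
    by (rule is_pullback_unique[OF assms(1)])
       (use P Q c d in \<open>simp_all add: Comp_reassoc[OF d(4)] Comp_reassoc[OF d(5)]\<close>)
  moreover have "c \<cdot> d = Ident E (Dom E q')"
    by (rule is_pullback_unique[OF q(1)])
       (use P Q c d in \<open>simp_all add: Comp_reassoc[OF c(4)] Comp_reassoc[OF c(5)]\<close>)
  ultimately have "is_iso E c"
    using c d by (intro is_isoI[of c _ _ d]) (simp_all add: in_Hom_iff)
  then show ?thesis using deflation_iso_Comp[OF q(2), of c "Dom E p'"] c by (simp add: in_Hom_iff)
qed

lemma pushout_inflation:
  assumes "is_pushout E i f i' f'" "inflation E i"
  shows "inflation E i'"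
proof -
  note P = is_pushoutD[OF assms(1)]
  obtain j' g' where j: "is_pushout E i f j' g'" "inflation E j'"
    using inflation_pushout[OF assms(2), of f] P by auto
  note Q = is_pushoutD[OF j(1)]
  obtain c where c: "c \<in> Arr E" "Cod E c = Cod E i'" "Dom E c = Cod E j'" "c \<cdot> g' = f'" "c \<cdot> j' = i'"
    using is_pushout_descE[OF j(1), of f' i'] P by metis
  obtain d where d: "d \<in> Arr E" "Cod E d = Cod E j'" "Dom E d = Cod E i'" "d \<cdot> f' = g'" "d \<cdot> i' = j'"
    using is_pushout_descE[OF assms(1), of g' j'] Q by metis
  have "c \<cdot> d = Ident E (Cod E i')"
    by (rule is_pushout_unique[OF assms(1)]) (use P Q c d in simp_all)
  moreover have "d \<cdot> c = Ident E (Cod E j')"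
    by (rule is_pushout_unique[OF j(1)]) (use P Q c d in simp_all)
  ultimately have "is_iso E c"
    using c d by (intro is_isoI[of c _ _ d]) (simp_all add: in_Hom_iff)
  then show ?thesis using iso_inflation_Comp[OF j(2), of c "Cod E i'"] c by (simp add: in_Hom_iff)
qed

text \<open>Base change does not alter the kernel: the pair (i, 0) lifts to an arrow
  \<open>i'\<close> into the pullback, and a test arrow killed by \<open>p'\<close> becomes, after
  \<open>f'\<close>, one killed by \<open>p\<close>.\<close>

lemma pullback_Confl:
  assumes "is_pullback E p f p' f'" "(i, p) \<in> Confl E"
  obtains i' where "(i', p') \<in> Confl E" "Dom E i' = Dom E i" "f' \<cdot> i' = i"
proof -
  note P = is_pullbackD[OF assms(1)] and C = Confl_simps[OF assms(2)]
  obtain i' where i': "i' \<in> Arr E" "Dom E i' = Dom E i" "Cod E i' = Dom E p'" "f' \<cdot> i' = i"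
    "p' \<cdot> i' = hom_zero E (Dom E i) (Dom E f)"
    using is_pullback_liftE[OF assms(1), of i "hom_zero E (Dom E i) (Dom E f)"] P C by auto
  have "is_kernel E i' p'"
  proof (rule is_kernelI)
    fix h assume h: "h \<in> Arr E" "Cod E h = Dom E p'" and h0: "p' \<cdot> h = hom_zero E (Dom E h) (Cod E p')"
    have "p \<cdot> (f' \<cdot> h) = hom_zero E (Dom E h) (Cod E p)"
      using P h h0 by (auto simp: Comp_reassoc[OF P(9)])
    then obtain k where k: "k \<in> Arr E" "Dom E k = Dom E h" "Cod E k = Dom E i" "i \<cdot> k = f' \<cdot> h"
      using Confl_kernelE[OF assms(2), of "f' \<cdot> h"] P h by auto
    have "i' \<cdot> k = h"
      by (rule is_pullback_unique[OF assms(1)])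
         (use P h k i' h0 in \<open>auto simp: Comp_reassoc[OF i'(4)] Comp_reassoc[OF i'(5)]\<close>)
    then show "\<exists>k. k \<in> Arr E \<and> Dom E k = Dom E h \<and> Cod E k = Dom E i' \<and> i' \<cdot> k = h"
      using k i' by auto
  next
    fix h k assume hk: "i' \<cdot> h = i' \<cdot> k" "h \<in> Arr E" "k \<in> Arr E" "Dom E h = Dom E k"
      "Cod E h = Dom E i'" "Cod E k = Dom E i'"
    then have "i \<cdot> h = i \<cdot> k"
      using i' P Comp_reassoc[OF i'(4), of h] Comp_reassoc[OF i'(4), of k] by simp
    then show "h = k" by (rule Confl_mono[OF assms(2)]) (use hk i' in simp_all)
  qed (use P i' in simp_all)
  moreover have "deflation E p'"
    using pullback_deflation[OF assms(1)] assms(2) by (auto simp: deflation_def)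
  ultimately have "(i', p') \<in> Confl E" by (intro deflation_kernel_Confl)
  then show ?thesis using that i' by blast
qed

text \<open>Dually, cobase change keeps the cokernel; \<open>p'\<close> is induced by the pair (p,
  0).\<close>

lemma pushout_Confl:
  assumes "is_pushout E i f i' f'" "(i, p) \<in> Confl E"
  obtains p' where "(i', p') \<in> Confl E" "Cod E p' = Cod E p" "p' \<cdot> f' = p"
proof -
  note P = is_pushoutD[OF assms(1)] and C = Confl_simps[OF assms(2)]
  obtain p' where p': "p' \<in> Arr E" "Cod E p' = Cod E p" "Dom E p' = Cod E i'" "p' \<cdot> f' = p"
    "p' \<cdot> i' = hom_zero E (Cod E f) (Cod E p)"
    using is_pushout_descE[OF assms(1), of p "hom_zero E (Cod E f) (Cod E p)"] P C by auto
  have "is_cokernel E p' i'"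
  proof (rule is_cokernelI)
    fix h assume h: "h \<in> Arr E" "Dom E h = Cod E i'" and h0: "h \<cdot> i' = hom_zero E (Dom E i') (Cod E h)"
    have "h \<cdot> f' \<cdot> i = h \<cdot> i' \<cdot> f" using P h by simp
    then have "h \<cdot> f' \<cdot> i = hom_zero E (Dom E i) (Cod E h)"
      using P h h0 by (simp del: Comp_assoc_Arr)
    then obtain k where k: "k \<in> Arr E" "Dom E k = Cod E p" "Cod E k = Cod E h" "k \<cdot> p = h \<cdot> f'"
      using Confl_cokernelE[OF assms(2), of "h \<cdot> f'"] P h by auto
    have "k \<cdot> p' = h"
      by (rule is_pushout_unique[OF assms(1)]) (use P h k p' h0 in auto)
    then show "\<exists>k. k \<in> Arr E \<and> Dom E k = Cod E p' \<and> Cod E k = Cod E h \<and> k \<cdot> p' = h"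
      using k p' by auto
  next
    fix h k assume hk: "h \<cdot> p' = k \<cdot> p'" "h \<in> Arr E" "k \<in> Arr E" "Cod E h = Cod E k"
      "Dom E h = Cod E p'" "Dom E k = Cod E p'"
    then have "h \<cdot> p = k \<cdot> p"
      using p' P Comp_assoc_Arr[of f' p' h] Comp_assoc_Arr[of f' p' k] by simp
    then show "h = k" by (rule Confl_epi[OF assms(2)]) (use hk p' in simp_all)
  qed (use P p' in simp_all)
  moreover have "inflation E i'"
    using pushout_inflation[OF assms(1)] assms(2) by (auto simp: inflation_def)
  ultimately have "(i', p') \<in> Confl E" by (intro inflation_cokernel_Confl)
  then show ?thesis using that p' by blast
qed

end

text \<open>The arrows are forgotten on purpose: the delooping arguments track only the three terms
  and can chain such facts without naming maps.\<close>

definition ses :: "('o, 'm, 'z) exact_cat_scheme \<Rightarrow> 'o \<Rightarrow> 'o \<Rightarrow> 'o \<Rightarrow> bool" where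
  "ses E A B C \<longleftrightarrow> (\<exists>i p. (i, p) \<in> Confl E \<and> i \<in> Hom E A B \<and> p \<in> Hom E B C)"

section \<open>Conflations as triples of objects\<close>

context exact_category
begin

lemma Confl_ses: "(i, p) \<in> Confl E \<Longrightarrow> ses E (Dom E i) (Cod E i) (Cod E p)"
  using Confl_simps[of i p] by (auto simp: ses_def in_Hom_iff)

lemma sesE:
  assumes "ses E A B C"
  obtains i p where "(i, p) \<in> Confl E" "i \<in> Arr E" "Dom E i = A" "Cod E i = B"
    "p \<in> Arr E" "Dom E p = B" "Cod E p = C" "p \<cdot> i = hom_zero E A C"
  using assms Confl_simps by (auto simp: ses_def in_Hom_iff)

lemma ses_Obj: "ses E A B C \<Longrightarrow> A \<in> Obj E \<and> B \<in> Obj E \<and> C \<in> Obj E"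
  by (auto elim!: sesE)

text \<open>The kernel of \<open>q \<cdot> p\<close> is the preimage under \<open>p\<close> of the
  kernel of \<open>q\<close>, that is, the pullback of \<open>l\<close> along \<open>p\<close>. The
  base change of \<open>p\<close> to it keeps the kernel of \<open>p\<close>.\<close>

lemma ses_comp_deflations:
  assumes "(k, p) \<in> Confl E" "(l, q) \<in> Confl E" "Cod E p = Dom E q"
  obtains m where "(m, q \<cdot> p) \<in> Confl E" "ses E (Dom E k) (Dom E m) (Dom E l)"
proof -
  note K = Confl_simps[OF assms(1)] and L = Confl_simps[OF assms(2)]
  obtain p' m where pb: "is_pullback E p l p' m"
    using deflation_pullback[of p l] K L assms by (auto simp: deflation_def)
  note P = is_pullbackD[OF pb]
  obtain k' where k': "(k', p') \<in> Confl E" "Dom E k' = Dom E k"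
    using pullback_Confl[OF pb assms(1)] by metis
  have "is_kernel E m (q \<cdot> p)"
  proof (rule is_kernelI)
    show "q \<cdot> p \<cdot> m = hom_zero E (Dom E m) (Cod E (q \<cdot> p))"
      using P K L assms(3) Comp_reassoc[OF L(4), of p'] by simp
    fix h assume h: "h \<in> Arr E" "Cod E h = Dom E (q \<cdot> p)"
      and h0: "q \<cdot> p \<cdot> h = hom_zero E (Dom E h) (Cod E (q \<cdot> p))"
    have "q \<cdot> (p \<cdot> h) = hom_zero E (Dom E h) (Cod E q)"
      using h0 h K L assms(3) by simp
    then obtain a where a: "a \<in> Arr E" "Dom E a = Dom E h" "Cod E a = Dom E l" "l \<cdot> a = p \<cdot> h"
      using Confl_kernelE[OF assms(2), of "p \<cdot> h"] h K L assms(3) by auto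
    obtain c where c: "c \<in> Arr E" "Dom E c = Dom E h" "Cod E c = Dom E p'" "m \<cdot> c = h"
      using is_pullback_liftE[OF pb, of h a] h a K L assms(3) by auto
    then show "\<exists>k. k \<in> Arr E \<and> Dom E k = Dom E h \<and> Cod E k = Dom E m \<and> m \<cdot> k = h"
      using P by auto
  next
    fix c d assume cd: "m \<cdot> c = m \<cdot> d" "c \<in> Arr E" "d \<in> Arr E" "Dom E c = Dom E d"
      "Cod E c = Dom E m" "Cod E d = Dom E m"
    have "l \<cdot> (p' \<cdot> c) = l \<cdot> (p' \<cdot> d)"
      using P cd Comp_reassoc[OF P(9), of c] Comp_reassoc[OF P(9), of d] by simp
    then have "p' \<cdot> c = p' \<cdot> d" by (rule Confl_mono[OF assms(2)]) (use P cd in simp_all)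
    then show "c = d" using is_pullback_unique[OF pb, of c d] P cd by simp
  qed (use P K L assms in simp_all)
  moreover have "deflation E (q \<cdot> p)"
    using deflation_Comp assms by (auto simp: deflation_def)
  ultimately have "(m, q \<cdot> p) \<in> Confl E" by (intro deflation_kernel_Confl)
  moreover have "ses E (Dom E k) (Dom E m) (Dom E l)"
    using Confl_ses[OF k'(1)] k' P Confl_simps[OF k'(1)] by simp
  ultimately show ?thesis using that by blast
qed

text \<open>Third isomorphism theorem, with the cokernel of the composite built as the pushout of
  \<open>j\<close> along \<open>p\<close>. It serves to keep that cokernel inside an
  extension-closed class.\<close>

lemma ses_comp_inflations:
  assumes "(i, p) \<in> Confl E" "(j, q) \<in> Confl E" "Cod E i = Dom E j"
  obtains r where "(j \<cdot> i, r) \<in> Confl E" "ses E (Cod E p) (Cod E r) (Cod E q)"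
proof -
  note K = Confl_simps[OF assms(1)] and L = Confl_simps[OF assms(2)]
  obtain j' r where po: "is_pushout E j p j' r"
    using inflation_pushout[of j p] K L assms by (auto simp: inflation_def)
  note P = is_pushoutD[OF po]
  obtain q' where q': "(j', q') \<in> Confl E" "Cod E q' = Cod E q"
    using pushout_Confl[OF po assms(2)] by metis
  have "is_cokernel E r (j \<cdot> i)"
  proof (rule is_cokernelI)
    show "r \<cdot> (j \<cdot> i) = hom_zero E (Dom E (j \<cdot> i)) (Cod E r)"
      using P K L assms(3) Comp_reassoc[OF P(9), of i] by simp
    fix h assume h: "h \<in> Arr E" "Dom E h = Cod E (j \<cdot> i)"
      and h0: "h \<cdot> (j \<cdot> i) = hom_zero E (Dom E (j \<cdot> i)) (Cod E h)"
    have "h \<cdot> j \<cdot> i = hom_zero E (Dom E i) (Cod E h)"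
      using h0 h K L assms(3) by simp
    then obtain a where a: "a \<in> Arr E" "Dom E a = Cod E p" "Cod E a = Cod E h" "a \<cdot> p = h \<cdot> j"
      using Confl_cokernelE[OF assms(1), of "h \<cdot> j"] h K L assms(3) by auto
    obtain c where c: "c \<in> Arr E" "Cod E c = Cod E h" "Dom E c = Cod E j'" "c \<cdot> r = h"
      using is_pushout_descE[OF po, of h a] h a K L assms(3) by auto
    then show "\<exists>k. k \<in> Arr E \<and> Dom E k = Cod E r \<and> Cod E k = Cod E h \<and> k \<cdot> r = h"
      using P by auto
  next
    fix c d assume cd: "c \<cdot> r = d \<cdot> r" "c \<in> Arr E" "d \<in> Arr E" "Cod E c = Cod E d"
      "Dom E c = Cod E r" "Dom E d = Cod E r"
    have "x \<cdot> r \<cdot> j = x \<cdot> j' \<cdot> p" if "x \<in> Arr E" "Dom E x = Cod E r" for x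
      using P that by simp
    from this[of c] this[of d] have "c \<cdot> j' \<cdot> p = d \<cdot> j' \<cdot> p" using cd by metis
    then have "c \<cdot> j' = d \<cdot> j'" by (rule Confl_epi[OF assms(1)]) (use P cd in simp_all)
    then show "c = d" using is_pushout_unique[OF po, of c d] P cd by simp
  qed (use P K L assms in simp_all)
  moreover have "inflation E (j \<cdot> i)"
    using inflation_Comp assms by (auto simp: inflation_def)
  ultimately have "(j \<cdot> i, r) \<in> Confl E" by (intro inflation_cokernel_Confl)
  moreover have "ses E (Cod E p) (Cod E r) (Cod E q)"
    using Confl_ses[OF q'(1)] q' P Confl_simps[OF q'(1)] by simp
  ultimately show ?thesis using that by blast
qed

lemma ses_comp:
  assumes "ses E K B C" "ses E L C D"
  obtains M where "ses E K M L" "ses E M B D"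
proof -
  obtain k p where kp: "(k, p) \<in> Confl E" "Dom E k = K" "Cod E k = B" "Dom E p = B" "Cod E p = C" "p \<in> Arr E"
    using assms(1) by (auto elim: sesE)
  obtain l q where lq: "(l, q) \<in> Confl E" "Dom E l = L" "Dom E q = C" "Cod E q = D" "q \<in> Arr E"
    using assms(2) by (auto elim: sesE)
  obtain m where m: "(m, q \<cdot> p) \<in> Confl E" "ses E K (Dom E m) L"
    using ses_comp_deflations[OF kp(1) lq(1)] kp lq by auto
  show ?thesis using that[OF m(2)] Confl_ses[OF m(1)] Confl_simps[OF m(1)] kp lq by simp
qed

text \<open>One pullback of the two deflations onto \<open>C\<close> serves both conclusions, since
  base change in either direction keeps the kernel. When \<open>P\<close> is projective the second
  conflation splits, so that \<open>W\<close> is A \<oplus> P.\<close>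

lemma ses_pullback:
  assumes "ses E A B C" "ses E G P C"
  obtains W where "ses E G W B" "ses E A W P"
proof -
  obtain i p where ip: "(i, p) \<in> Confl E" "Dom E i = A" "Dom E p = B" "Cod E p = C" "p \<in> Arr E"
    using assms(1) by (auto elim: sesE)
  obtain g q where gq: "(g, q) \<in> Confl E" "Dom E g = G" "Dom E q = P" "Cod E q = C" "q \<in> Arr E"
    using assms(2) by (auto elim: sesE)
  obtain p' q' where pb: "is_pullback E p q p' q'"
    using deflation_pullback[of p q] ip gq by (auto simp: deflation_def)
  note P = is_pullbackD[OF pb]
  obtain i' where i': "(i', p') \<in> Confl E" "Dom E i' = A"
    using pullback_Confl[OF pb ip(1)] ip by metis
  obtain g' where g': "(g', q') \<in> Confl E" "Dom E g' = G"
    using pullback_Confl[OF is_pullback_sym[OF pb] gq(1)] gq by metis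
  show ?thesis
    using that[of "Dom E p'"] Confl_ses[OF i'(1)] Confl_ses[OF g'(1)] Confl_simps[OF i'(1)]
      Confl_simps[OF g'(1)] P i' g' ip gq by simp
qed

end

section \<open>The stable category\<close>

context preadditive_category
begin

lemma hom_neg_zero [simp]:
  assumes "X \<in> Obj C" "Y \<in> Obj C"
  shows "hom_neg C (hom_zero C X Y) = hom_zero C X Y"
  by (rule hom_add_left_cancel[of "hom_zero C X Y"]) (use assms in simp_all)

end

section \<open>Projectives, the ideal they generate, and stable retracts\<close>

context exact_category
begin

lemma projective_Obj: "projective E P \<Longrightarrow> P \<in> Obj E"
  by (simp add: projective_def)

lemma projective_liftE:
  assumes "projective E P" "(i, p) \<in> Confl E" "f \<in> Arr E" "Dom E f = P" "Cod E f = Cod E p"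
  obtains g where "g \<in> Arr E" "Dom E g = P" "Cod E g = Dom E p" "p \<cdot> g = f"
proof -
  have "\<exists>g\<in>Hom E P (Dom E p). p \<cdot> g = f"
    using assms unfolding projective_def deflation_def in_Hom_iff by blast
  then show ?thesis using that by (auto simp: in_Hom_iff)
qed

lemma projectiveI:
  assumes "P \<in> Obj E"
    and "\<And>i p f. \<lbrakk>(i, p) \<in> Confl E; f \<in> Arr E; Dom E f = P; Cod E f = Cod E p\<rbrakk> \<Longrightarrow>
      \<exists>g. g \<in> Arr E \<and> Dom E g = P \<and> Cod E g = Dom E p \<and> p \<cdot> g = f"
  shows "projective E P"
  unfolding projective_def
proof (intro conjI allI impI)
  fix p f assume "deflation E p \<and> f \<in> Hom E P (Cod E p)"
  then obtain i where "(i, p) \<in> Confl E" "f \<in> Arr E" "Dom E f = P" "Cod E f = Cod E p"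
    by (auto simp: deflation_def in_Hom_iff)
  from assms(2)[OF this] show "\<exists>g\<in>Hom E P (Dom E p). p \<cdot> g = f" by (auto simp: in_Hom_iff)
qed (rule assms)

text \<open>The section \<open>s\<close> lifts the identity; 1 - s p is then killed by
  \<open>p\<close> and factors through \<open>i\<close>, which defines \<open>r\<close>.\<close>

lemma Confl_splitE:
  assumes "(i, p) \<in> Confl E" "projective E (Cod E p)"
  obtains r s where "r \<in> Arr E" "Dom E r = Dom E p" "Cod E r = Dom E i"
    "s \<in> Arr E" "Dom E s = Cod E p" "Cod E s = Dom E p"
    "r \<cdot> i = Ident E (Dom E i)" "p \<cdot> s = Ident E (Cod E p)"
    "i \<cdot> r \<boxplus> s \<cdot> p = Ident E (Dom E p)"
proof -
  note C = Confl_simps[OF assms(1)]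
  obtain s where s: "s \<in> Arr E" "Dom E s = Cod E p" "Cod E s = Dom E p" "p \<cdot> s = Ident E (Cod E p)"
    using projective_liftE[OF assms(2,1), of "Ident E (Cod E p)"] C by auto
  let ?e = "Ident E (Dom E p) \<boxplus> hom_neg E (s \<cdot> p)"
  have "p \<cdot> ?e = hom_zero E (Dom E ?e) (Cod E p)"
    using C s Comp_reassoc[OF s(4), of p] by simp
  then obtain r where r: "r \<in> Arr E" "Dom E r = Dom E p" "Cod E r = Dom E i" "i \<cdot> r = ?e"
    using Confl_kernelE[OF assms(1), of ?e] C s by auto
  have "i \<cdot> (r \<cdot> i) = i \<cdot> Ident E (Dom E i)"
    using C s r Comp_reassoc[OF r(4), of i] by simp
  then have "r \<cdot> i = Ident E (Dom E i)"
    by (rule Confl_mono[OF assms(1)]) (use C r in simp_all)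
  moreover have "i \<cdot> r \<boxplus> s \<cdot> p = Ident E (Dom E p)"
    using C s r by (simp add: hom_add_assoc)
  ultimately show ?thesis using that r s by blast
qed

lemma biproductE:
  assumes "is_biproduct E A B D"
  obtains i j p q where "i \<in> Arr E" "Dom E i = A" "Cod E i = D" "j \<in> Arr E" "Dom E j = B" "Cod E j = D"
    "p \<in> Arr E" "Dom E p = D" "Cod E p = A" "q \<in> Arr E" "Dom E q = D" "Cod E q = B"
    "p \<cdot> i = Ident E A" "q \<cdot> j = Ident E B" "p \<cdot> j = hom_zero E B A" "q \<cdot> i = hom_zero E A B"
    "i \<cdot> p \<boxplus> j \<cdot> q = Ident E D"
  using assms unfolding is_biproduct_def in_Hom_iff by (auto simp: in_Hom_iff)

lemma biproduct_projective:
  assumes "is_biproduct E P Q D" "projective E P" "projective E Q"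
  shows "projective E D"
proof -
  obtain i j p q where b: "i \<in> Arr E" "Dom E i = P" "Cod E i = D" "j \<in> Arr E" "Dom E j = Q" "Cod E j = D"
    "p \<in> Arr E" "Dom E p = D" "Cod E p = P" "q \<in> Arr E" "Dom E q = D" "Cod E q = Q"
    "i \<cdot> p \<boxplus> j \<cdot> q = Ident E D"
    using assms(1) by (rule biproductE)
  show ?thesis
  proof (rule projectiveI)
    show "D \<in> Obj E" using b by auto
    fix k d f assume d: "(k, d) \<in> Confl E" and f: "f \<in> Arr E" "Dom E f = D" "Cod E f = Cod E d"
    note C = Confl_simps[OF d]
    obtain g where g: "g \<in> Arr E" "Dom E g = P" "Cod E g = Dom E d" "d \<cdot> g = f \<cdot> i"
      using projective_liftE[OF assms(2) d, of "f \<cdot> i"] f b by auto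
    obtain h where h: "h \<in> Arr E" "Dom E h = Q" "Cod E h = Dom E d" "d \<cdot> h = f \<cdot> j"
      using projective_liftE[OF assms(3) d, of "f \<cdot> j"] f b by auto
    have "d \<cdot> (g \<cdot> p \<boxplus> h \<cdot> q) = f \<cdot> (i \<cdot> p \<boxplus> j \<cdot> q)"
      using C f b(1-12) g h Comp_reassoc[OF g(4), of p] Comp_reassoc[OF h(4), of q] by simp
    then have "d \<cdot> (g \<cdot> p \<boxplus> h \<cdot> q) = f" using b(13) f by simp
    then show "\<exists>g. g \<in> Arr E \<and> Dom E g = D \<and> Cod E g = Dom E d \<and> d \<cdot> g = f"
      by (intro exI[of _ "g \<cdot> p \<boxplus> h \<cdot> q"]) (use C b g h in simp)
  qed
qed

lemma zero_object_projective:
  assumes "is_zero_object E Z"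
  shows "projective E Z"
proof (rule projectiveI)
  show Z: "Z \<in> Obj E" using assms by (simp add: is_zero_object_def)
  fix i p f assume i: "(i, p) \<in> Confl E" and f: "f \<in> Arr E" "Dom E f = Z" "Cod E f = Cod E p"
  have "f = hom_zero E Z (Cod E p)" using zero_object_Hom(1)[OF assms, of f "Cod E p"] f by (simp add: in_Hom_iff)
  then show "\<exists>g. g \<in> Arr E \<and> Dom E g = Z \<and> Cod E g = Dom E p \<and> p \<cdot> g = f"
    using Confl_simps[OF i] Z by (intro exI[of _ "hom_zero E Z (Dom E p)"]) simp
qed

lemma ses_projective:
  assumes "ses E P V Q" "projective E P" "projective E Q"
  shows "projective E V"
proof -
  obtain i p where ip: "(i, p) \<in> Confl E" "Dom E i = P" "Dom E p = V" "Cod E p = Q"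
    using assms(1) by (auto elim: sesE)
  obtain r s where rs: "r \<in> Arr E" "Dom E r = Dom E p" "Cod E r = Dom E i"
    "s \<in> Arr E" "Dom E s = Cod E p" "Cod E s = Dom E p"
    "r \<cdot> i = Ident E (Dom E i)" "p \<cdot> s = Ident E (Cod E p)"
    "i \<cdot> r \<boxplus> s \<cdot> p = Ident E (Dom E p)"
    using Confl_splitE[OF ip(1)] assms(3) ip by auto
  note C = Confl_simps[OF ip(1)]
  have Obj: "P \<in> Obj E" "V \<in> Obj E" "Q \<in> Obj E" using ses_Obj[OF assms(1)] by auto
  \<comment> \<open>The one biproduct equation that \<open>Confl_splitE\<close> does not supply.
    Composing i r + s p = 1 with \<open>s\<close> and cancelling \<open>s\<close> gives i r s = 0,
    and \<open>i\<close> is monic.\<close>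
  have "r \<cdot> s = hom_zero E Q P"
  proof (rule Confl_mono[OF ip(1)])
    have "i \<cdot> r \<cdot> s \<boxplus> s = (i \<cdot> r \<boxplus> s \<cdot> p) \<cdot> s" using rs(1-8) C Obj by simp
    also have "\<dots> = hom_zero E Q V \<boxplus> s" using rs C ip Obj by simp
    finally have "i \<cdot> r \<cdot> s \<boxplus> s = hom_zero E Q V \<boxplus> s" .
    then have "s \<boxplus> i \<cdot> r \<cdot> s = s \<boxplus> hom_zero E Q V"
      using rs C ip Obj by (simp add: hom_add_commute[of s])
    then show "i \<cdot> (r \<cdot> s) = i \<cdot> hom_zero E Q P"
      using hom_add_left_cancel[of s "i \<cdot> r \<cdot> s" "hom_zero E Q V"] rs C ip Obj by auto
  qed (use rs C ip Obj in auto)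
  then have "is_biproduct E P Q V"
    unfolding is_biproduct_def using rs C ip
    by (intro bexI[of _ i] bexI[of _ s] bexI[of _ r] bexI[of _ p]) (auto simp: in_Hom_iff)
  then show ?thesis by (rule biproduct_projective) (rule assms)+
qed

lemma proj_idealI:
  assumes "projective E (Cod E g)" "g \<in> Arr E" "h \<in> Arr E" "Dom E h = Cod E g"
    "Dom E g = X" "Cod E h = Y" "f = h \<cdot> g"
  shows "f \<in> proj_ideal E X Y"
proof -
  have "g \<in> Hom E X (Cod E g)" "h \<in> Hom E (Cod E g) Y" "f \<in> Hom E X Y"
    using assms by (simp_all add: in_Hom_iff)
  then show ?thesis unfolding proj_ideal_def using assms(1,7) by blast
qed

lemma proj_idealE:
  assumes "f \<in> proj_ideal E X Y"
  obtains g h where "projective E (Cod E g)" "g \<in> Arr E" "h \<in> Arr E" "Dom E h = Cod E g"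
    "Dom E g = X" "Cod E h = Y" "f = h \<cdot> g"
proof -
  obtain P g h where "projective E P" "g \<in> Hom E X P" "h \<in> Hom E P Y" "f = h \<cdot> g"
    using assms unfolding proj_ideal_def by blast
  then show ?thesis using that[of g h] by (simp add: in_Hom_iff)
qed

lemma proj_ideal_Arr: 
  assumes "f \<in> proj_ideal E X Y"
  shows "f \<in> Arr E" "Dom E f = X" "Cod E f = Y"
  using assms unfolding proj_ideal_def in_Hom_iff by blast+

lemma proj_ideal_Comp:
  assumes "e \<in> proj_ideal E X Y" "f \<in> Arr E"
  shows "Dom E f = Y \<Longrightarrow> f \<cdot> e \<in> proj_ideal E X (Cod E f)"
    "Cod E f = X \<Longrightarrow> e \<cdot> f \<in> proj_ideal E (Dom E f) Y"
proof -
  obtain g h where gh: "projective E (Cod E g)" "g \<in> Arr E" "h \<in> Arr E" "Dom E h = Cod E g"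
    "Dom E g = X" "Cod E h = Y" "e = h \<cdot> g"
    using assms(1) by (rule proj_idealE)
  show "f \<cdot> e \<in> proj_ideal E X (Cod E f)" if "Dom E f = Y"
    by (rule proj_idealI[of g "f \<cdot> h"]) (use gh that assms(2) in simp_all)
  show "e \<cdot> f \<in> proj_ideal E (Dom E f) Y" if "Cod E f = X"
    by (rule proj_idealI[of "g \<cdot> f" h]) (use gh that assms(2) in simp_all)
qed

lemma proj_ideal_zero:
  assumes "X \<in> Obj E" "Y \<in> Obj E"
  shows "hom_zero E X Y \<in> proj_ideal E X Y"
proof -
  obtain Z where Z: "is_zero_object E Z" using zero_object_exists by blast
  then have "projective E Z" by (rule zero_object_projective)
  then show ?thesis
    using projective_Obj assms by (intro proj_idealI[of "hom_zero E X Z" "hom_zero E Z Y"]) simp_all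
qed

lemma proj_ideal_neg:
  assumes "f \<in> proj_ideal E X Y"
  shows "hom_neg E f \<in> proj_ideal E X Y"
proof -
  obtain g h where "projective E (Cod E g)" "g \<in> Arr E" "h \<in> Arr E" "Dom E h = Cod E g"
    "Dom E g = X" "Cod E h = Y" "f = h \<cdot> g"
    using assms by (rule proj_idealE)
  then show ?thesis by (intro proj_idealI[of g "hom_neg E h"]) simp_all
qed

text \<open>The sum factors through the biproduct of the two intermediate projectives, which is
  again projective.\<close>

lemma proj_ideal_add:
  assumes "f \<in> proj_ideal E X Y" "f' \<in> proj_ideal E X Y"
  shows "f \<boxplus> f' \<in> proj_ideal E X Y"
proof -
  obtain g h where gh: "projective E (Cod E g)" "g \<in> Arr E" "h \<in> Arr E" "Dom E h = Cod E g"
    "Dom E g = X" "Cod E h = Y" "f = h \<cdot> g"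
    using assms(1) by (rule proj_idealE)
  obtain g' h' where gh': "projective E (Cod E g')" "g' \<in> Arr E" "h' \<in> Arr E" "Dom E h' = Cod E g'"
    "Dom E g' = X" "Cod E h' = Y" "f' = h' \<cdot> g'"
    using assms(2) by (rule proj_idealE)
  obtain D where D: "is_biproduct E (Cod E g) (Cod E g') D"
    using biproduct_exists[of "Cod E g" "Cod E g'"] gh gh' by auto
  obtain i j p q where b: "i \<in> Arr E" "Dom E i = Cod E g" "Cod E i = D" "j \<in> Arr E" "Dom E j = Cod E g'" "Cod E j = D"
    "p \<in> Arr E" "Dom E p = D" "Cod E p = Cod E g" "q \<in> Arr E" "Dom E q = D" "Cod E q = Cod E g'"
    and c: "p \<cdot> i = Ident E (Cod E g)" "q \<cdot> j = Ident E (Cod E g')"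
    "p \<cdot> j = hom_zero E (Cod E g') (Cod E g)" "q \<cdot> i = hom_zero E (Cod E g) (Cod E g')"
    using D by (rule biproductE)
  have "f \<boxplus> f' = (h \<cdot> p \<boxplus> h' \<cdot> q) \<cdot> (i \<cdot> g \<boxplus> j \<cdot> g')"
    using gh gh' b Dom_Obj[of g] by (simp add: Comp_reassoc[OF c(1)] Comp_reassoc[OF c(2)] Comp_reassoc[OF c(3)] Comp_reassoc[OF c(4)])
  then show ?thesis
    by (intro proj_idealI[of "i \<cdot> g \<boxplus> j \<cdot> g'" "h \<cdot> p \<boxplus> h' \<cdot> q"])
       (use gh gh' b biproduct_projective[OF D gh(1) gh'(1)] in simp_all)
qed

text \<open>Makes the cosets in \<open>stable_class\<close> a partition, so that representatives can
  be exchanged in \<open>stable_class_eqI\<close>.\<close>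

lemma proj_ideal_subgroup:
  assumes "X \<in> Obj E" "Y \<in> Obj E"
  shows "subgroup (proj_ideal E X Y) (hom_group E X Y)"
proof -
  interpret G: comm_group "hom_group E X Y" using assms by (rule hom_comm_group)
  show ?thesis
  proof (rule G.subgroupI)
    show "proj_ideal E X Y \<subseteq> carrier (hom_group E X Y)"
      using proj_ideal_Arr by (auto simp: in_Hom_iff)
    show "proj_ideal E X Y \<noteq> {}" using proj_ideal_zero[OF assms] by auto
    fix f assume f: "f \<in> proj_ideal E X Y"
    have "inv\<^bsub>hom_group E X Y\<^esub> f = hom_neg E f" using proj_ideal_Arr[OF f] by (simp add: hom_neg_def)
    then show "inv\<^bsub>hom_group E X Y\<^esub> f \<in> proj_ideal E X Y" using proj_ideal_neg[OF f] by simp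
    fix g assume "g \<in> proj_ideal E X Y"
    then show "f \<otimes>\<^bsub>hom_group E X Y\<^esub> g \<in> proj_ideal E X Y" using f proj_ideal_add by simp
  qed
qed

lemma stable_class_iff:
  "g \<in> stable_class E f \<longleftrightarrow> (\<exists>e \<in> proj_ideal E (Dom E f) (Cod E f). g = e \<boxplus> f)"
  by (auto simp: stable_class_def r_coset_def)

lemma stable_class_self: "f \<in> Arr E \<Longrightarrow> f \<in> stable_class E f"
  unfolding stable_class_iff by (intro bexI[of _ "hom_zero E (Dom E f) (Cod E f)"]) (simp_all add: proj_ideal_zero)

lemma stable_class_Arr:
  assumes "f \<in> Arr E" "g \<in> stable_class E f"
  shows "g \<in> Arr E" "Dom E g = Dom E f" "Cod E g = Cod E f"
  using assms proj_ideal_Arr by (auto simp: stable_class_iff)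

lemma stable_class_eqI:
  assumes "f \<in> Arr E" "g \<in> stable_class E f"
  shows "stable_class E g = stable_class E f"
proof -
  let ?G = "hom_group E (Dom E f) (Cod E f)"
  interpret G: comm_group ?G using assms by (intro hom_comm_group) simp_all
  have "proj_ideal E (Dom E f) (Cod E f) #>\<^bsub>?G\<^esub> f = proj_ideal E (Dom E f) (Cod E f) #>\<^bsub>?G\<^esub> g"
    using assms by (intro G.repr_independence proj_ideal_subgroup)
      (simp_all add: in_Hom_iff stable_class_def)
  then show ?thesis using stable_class_Arr[OF assms] by (simp add: stable_class_def)
qed

text \<open>Composition of classes is well defined: (d + g)(e + f) differs from g f by (d + g) e + d
  f, which lies in the ideal. The union in \<open>stable_category\<close> is thus a union of copies
  of one class.\<close>

lemma stable_class_Comp: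
  assumes "f \<in> Arr E" "g \<in> Arr E" "Cod E f = Dom E g"
  shows "(\<Union>g' \<in> stable_class E g. \<Union>f' \<in> stable_class E f. stable_class E (g' \<cdot> f')) = stable_class E (g \<cdot> f)"
proof -
  have *: "stable_class E (g' \<cdot> f') = stable_class E (g \<cdot> f)"
    if g': "g' \<in> stable_class E g" and f': "f' \<in> stable_class E f" for f' g'
  proof -
    note A = stable_class_Arr[OF assms(1) f'] stable_class_Arr[OF assms(2) g']
    obtain e where e: "e \<in> proj_ideal E (Dom E f) (Cod E f)" "f' = e \<boxplus> f"
      using f' by (auto simp: stable_class_iff)
    obtain d where d: "d \<in> proj_ideal E (Dom E g) (Cod E g)" "g' = d \<boxplus> g"
      using g' by (auto simp: stable_class_iff)
    have ed: "g' \<cdot> e \<in> proj_ideal E (Dom E f) (Cod E g)" "d \<cdot> f \<in> proj_ideal E (Dom E f) (Cod E g)"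
      using proj_ideal_Comp(1)[OF e(1), of g'] proj_ideal_Comp(2)[OF d(1), of f] A assms by simp_all
    have "g' \<cdot> f' = g' \<cdot> e \<boxplus> g' \<cdot> f"
      unfolding e(2) using proj_ideal_Arr[OF e(1)] A assms by simp
    also have "g' \<cdot> f = d \<cdot> f \<boxplus> g \<cdot> f"
      unfolding d(2) using proj_ideal_Arr[OF d(1)] A assms by simp
    also have "g' \<cdot> e \<boxplus> (d \<cdot> f \<boxplus> g \<cdot> f) = g' \<cdot> e \<boxplus> d \<cdot> f \<boxplus> g \<cdot> f"
      by (rule hom_add_assoc[symmetric]) (use proj_ideal_Arr[OF ed(1)] proj_ideal_Arr[OF ed(2)] assms in simp_all)
    finally have "g' \<cdot> f' \<in> stable_class E (g \<cdot> f)"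
      using proj_ideal_add[OF ed] assms by (auto simp: stable_class_iff)
    then show ?thesis by (rule stable_class_eqI[rotated]) (use assms in simp)
  qed
  \<comment> \<open>Over an empty index set the union would be empty instead of the common
    class.\<close>
  have "stable_class E f \<noteq> {}" "stable_class E g \<noteq> {}"
    using stable_class_self assms by blast+
  then show ?thesis by (simp add: * cong: SUP_cong)
qed

lemma stable_Hom_iff:
  "c \<in> Hom (stable_category E) X Y \<longleftrightarrow> (\<exists>f \<in> Hom E X Y. c = stable_class E f)"
proof -
  \<comment> \<open>\<open>Dom\<close> and \<open>Cod\<close> of a class are definite descriptions;
    they denote because the class contains \<open>f\<close> and all its members are
    parallel.\<close>
  have D: "Dom (stable_category E) (stable_class E f) = Dom E f"
    "Cod (stable_category E) (stable_class E f) = Cod E f" if "f \<in> Arr E" for f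
    unfolding stable_category_def cat.simps
    using stable_class_self[OF that] stable_class_Arr[OF that] by (blast intro: the_equality)+
  show ?thesis
  proof
    assume "c \<in> Hom (stable_category E) X Y"
    then obtain f where "f \<in> Arr E" "c = stable_class E f" "Dom (stable_category E) c = X"
      "Cod (stable_category E) c = Y"
      by (auto simp: Hom_def stable_category_def)
    then show "\<exists>f \<in> Hom E X Y. c = stable_class E f" using D by (auto simp: in_Hom_iff)
  next
    assume "\<exists>f \<in> Hom E X Y. c = stable_class E f"
    then obtain f where f: "f \<in> Arr E" "Dom E f = X" "Cod E f = Y" "c = stable_class E f"
      by (auto simp: in_Hom_iff)
    then have "c \<in> Arr (stable_category E)" by (simp add: stable_category_def)
    then show "c \<in> Hom (stable_category E) X Y" using D f by (simp add: Hom_def)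
  qed
qed

text \<open>Two cosets agree exactly when their representatives differ by an arrow through a
  projective, so a stable retraction amounts to honest arrows and an error term \<open>e\<close>.
  All later work uses this form instead of cosets.\<close>

lemma stable_retract_iff:
  "stable_retract E X Y \<longleftrightarrow>
     (\<exists>u v e. u \<in> Hom E X Y \<and> v \<in> Hom E Y X \<and> e \<in> proj_ideal E X X \<and> Ident E X = e \<boxplus> v \<cdot> u)"
  (is "_ \<longleftrightarrow> ?R")
proof
  assume "stable_retract E X Y"
  then obtain u v where uv: "u \<in> Hom E X Y" "v \<in> Hom E Y X"
    "Comp (stable_category E) (stable_class E v) (stable_class E u) = Ident (stable_category E) X"
    unfolding stable_retract_def is_retract_def Bex_def stable_Hom_iff by blast
  then have A: "u \<in> Arr E" "v \<in> Arr E" "Dom E u = X" "Cod E u = Y" "Dom E v = Y" "Cod E v = X" "X \<in> Obj E"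
    by (auto simp: in_Hom_iff)
  have "stable_class E (Ident E X) = stable_class E (v \<cdot> u)"
    using uv(3) stable_class_Comp[of u v] A by (simp add: stable_category_def)
  then have "Ident E X \<in> stable_class E (v \<cdot> u)" using stable_class_self[of "Ident E X"] A by simp
  moreover have "Dom E (v \<cdot> u) = X" "Cod E (v \<cdot> u) = X" using A by simp_all
  ultimately show ?R using uv(1,2) unfolding stable_class_iff by metis
next
  assume ?R
  then obtain u v e where uv: "u \<in> Hom E X Y" "v \<in> Hom E Y X" "e \<in> proj_ideal E X X" "Ident E X = e \<boxplus> v \<cdot> u"
    by blast
  then have A: "u \<in> Arr E" "v \<in> Arr E" "Dom E u = X" "Cod E u = Y" "Dom E v = Y" "Cod E v = X" "X \<in> Obj E"
    by (auto simp: in_Hom_iff)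
  have "Dom E (v \<cdot> u) = X" "Cod E (v \<cdot> u) = X" using A by simp_all
  then have "Ident E X \<in> stable_class E (v \<cdot> u)" unfolding stable_class_iff using uv(3,4) by metis
  then have "stable_class E (Ident E X) = stable_class E (v \<cdot> u)"
    by (rule stable_class_eqI[rotated]) (use A in simp)
  then have "Comp (stable_category E) (stable_class E v) (stable_class E u) = Ident (stable_category E) X"
    using stable_class_Comp[of u v] A by (simp add: stable_category_def)
  then show "stable_retract E X Y"
    unfolding stable_retract_def is_retract_def Bex_def stable_Hom_iff using uv by blast
qed

lemma stable_retractE:
  assumes "stable_retract E X Y"
  obtains u v e where "u \<in> Arr E" "Dom E u = X" "Cod E u = Y" "v \<in> Arr E" "Dom E v = Y" "Cod E v = X"
    "e \<in> proj_ideal E X X" "Ident E X = e \<boxplus> v \<cdot> u" "X \<in> Obj E" "Y \<in> Obj E"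
proof -
  obtain u v e where uv: "u \<in> Hom E X Y" "v \<in> Hom E Y X" "e \<in> proj_ideal E X X" "Ident E X = e \<boxplus> v \<cdot> u"
    using assms unfolding stable_retract_iff by blast
  then have "X \<in> Obj E" "Y \<in> Obj E" by (auto simp: in_Hom_iff)
  then show ?thesis using that uv unfolding in_Hom_iff by blast
qed

lemma stable_retract_Obj: "stable_retract E X Y \<Longrightarrow> X \<in> Obj E \<and> Y \<in> Obj E"
  by (auto elim: stable_retractE)

lemma stable_retractI:
  assumes "u \<in> Arr E" "Dom E u = X" "Cod E u = Y" "v \<in> Arr E" "Dom E v = Y" "Cod E v = X"
    "e \<in> proj_ideal E X X" "Ident E X = e \<boxplus> v \<cdot> u"
  shows "stable_retract E X Y"
  unfolding stable_retract_iff in_Hom_iff using assms by blast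

lemma retract_stable_retract:
  assumes "is_retract E X Y"
  shows "stable_retract E X Y"
proof -
  obtain u v where uv: "u \<in> Arr E" "Dom E u = X" "Cod E u = Y" "v \<in> Arr E" "Dom E v = Y" "Cod E v = X"
    "v \<cdot> u = Ident E X"
    using assms unfolding is_retract_def by (auto simp: in_Hom_iff)
  then have "X \<in> Obj E" by auto
  then show ?thesis
    using uv by (intro stable_retractI[of u X Y v "hom_zero E X X"]) (simp_all add: proj_ideal_zero)
qed

lemma stable_retract_refl: "X \<in> Obj E \<Longrightarrow> stable_retract E X X"
  by (rule retract_stable_retract, unfold is_retract_def)
     (intro bexI[of _ "Ident E X"], simp_all add: in_Hom_iff)

text \<open>Inserting 1 = e' + v' u' between \<open>v\<close> and \<open>u\<close> leaves the error
  e + v e' u, which stays in the ideal.\<close>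

lemma stable_retract_trans:
  assumes "stable_retract E X Y" "stable_retract E Y Z"
  shows "stable_retract E X Z"
proof -
  obtain u v e where u: "u \<in> Arr E" "Dom E u = X" "Cod E u = Y" "v \<in> Arr E" "Dom E v = Y" "Cod E v = X"
    and e: "e \<in> proj_ideal E X X" "Ident E X = e \<boxplus> v \<cdot> u"
    using assms(1) by (rule stable_retractE)
  obtain u' v' e' where u': "u' \<in> Arr E" "Dom E u' = Y" "Cod E u' = Z" "v' \<in> Arr E" "Dom E v' = Z" "Cod E v' = Y"
    and e': "e' \<in> proj_ideal E Y Y" "Ident E Y = e' \<boxplus> v' \<cdot> u'"
    using assms(2) by (rule stable_retractE)
  note A = proj_ideal_Arr[OF e(1)] proj_ideal_Arr[OF e'(1)]
  have veu: "v \<cdot> e' \<cdot> u \<in> proj_ideal E X X"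
    using proj_ideal_Comp(2)[OF proj_ideal_Comp(1)[OF e'(1)], of v u] u by simp
  have "v \<cdot> u = v \<cdot> (Ident E Y \<cdot> u)" using u by simp
  also have "\<dots> = v \<cdot> e' \<cdot> u \<boxplus> v \<cdot> v' \<cdot> (u' \<cdot> u)" unfolding e'(2) using u u' A by simp
  finally have "Ident E X = e \<boxplus> (v \<cdot> e' \<cdot> u \<boxplus> v \<cdot> v' \<cdot> (u' \<cdot> u))" using e(2) by simp
  also have "\<dots> = e \<boxplus> v \<cdot> e' \<cdot> u \<boxplus> v \<cdot> v' \<cdot> (u' \<cdot> u)"
    by (rule hom_add_assoc[symmetric]) (use u u' A in simp_all)
  finally show ?thesis
    using u u' proj_ideal_add[OF e(1) veu] by (intro stable_retractI[of "u' \<cdot> u" X Z "v \<cdot> v'"]) simp_all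
qed

text \<open>A projective is stably zero: its identity lies in the ideal, so zero arrows serve as
  \<open>u\<close> and \<open>v\<close>.\<close>

lemma projective_stable_retract:
  assumes "projective E P" "Y \<in> Obj E"
  shows "stable_retract E P Y"
proof -
  have "P \<in> Obj E" by (rule projective_Obj) fact
  then have "Ident E P \<in> proj_ideal E P P"
    using assms by (intro proj_idealI[of "Ident E P" "Ident E P"]) simp_all
  then show ?thesis
    using \<open>P \<in> Obj E\<close> assms
    by (intro stable_retractI[of "hom_zero E P Y" P Y "hom_zero E Y P" "Ident E P"]) simp_all
qed

text \<open>A conflation ending in a projective splits, and the error \<open>s \<cdot> p\<close> of
  the splitting factors through \<open>P\<close>; so \<open>A\<close> and \<open>W\<close> are
  stably isomorphic.\<close>

lemma ses_projective_stable_retract: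
  assumes "ses E A W P" "projective E P"
  shows "stable_retract E W A" "stable_retract E A W"
proof -
  obtain i p where ip: "(i, p) \<in> Confl E" "Dom E i = A" "Dom E p = W" "Cod E p = P"
    using assms(1) by (auto elim: sesE)
  obtain r s where rs: "r \<in> Arr E" "Dom E r = Dom E p" "Cod E r = Dom E i"
    "s \<in> Arr E" "Dom E s = Cod E p" "Cod E s = Dom E p"
    "r \<cdot> i = Ident E (Dom E i)" "p \<cdot> s = Ident E (Cod E p)" "i \<cdot> r \<boxplus> s \<cdot> p = Ident E (Dom E p)"
    using Confl_splitE[OF ip(1)] assms(2) ip(4) by blast
  note C = Confl_simps[OF ip(1)]
  have "is_retract E A W"
    unfolding is_retract_def using rs C ip by (intro bexI[of _ i] bexI[of _ r]) (simp_all add: in_Hom_iff)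
  then show "stable_retract E A W" by (rule retract_stable_retract)
  have "s \<cdot> p \<in> proj_ideal E W W"
    using rs C ip assms(2) by (intro proj_idealI[of p s]) simp_all
  moreover have "Ident E W = s \<cdot> p \<boxplus> i \<cdot> r"
    using rs(1-6) C ip hom_add_commute[of "s \<cdot> p" "i \<cdot> r"] rs(9) by simp
  ultimately show "stable_retract E W A"
    using rs C ip by (intro stable_retractI[of r W A i]) simp_all
qed

text \<open>Functoriality of the syzygy and independence of its choice in one statement: for
  \<open>X\<close> equal to \<open>Y\<close> it compares two syzygies of one object, as Schanuel's
  lemma does. A lift to \<open>P\<close> of the identity of \<open>X\<close> differs from 1 by an
  arrow through \<open>A\<close>, and restricted to \<open>A\<close> that difference factors through
  \<open>P\<close>.\<close>

lemma stable_retract_syzygy: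
  assumes "stable_retract E X Y" "ses E A P X" "ses E B Q Y" "projective E P" "projective E Q"
  shows "stable_retract E A B"
proof -
  obtain u v e where u: "u \<in> Arr E" "Dom E u = X" "Cod E u = Y" "v \<in> Arr E" "Dom E v = Y" "Cod E v = X"
    and e: "e \<in> proj_ideal E X X" "Ident E X = e \<boxplus> v \<cdot> u"
    using assms(1) by (rule stable_retractE)
  obtain g h where gh: "projective E (Cod E g)" "g \<in> Arr E" "h \<in> Arr E" "Dom E h = Cod E g"
    "Dom E g = X" "Cod E h = X" "e = h \<cdot> g"
    using e(1) by (rule proj_idealE)
  obtain i p where ip: "(i, p) \<in> Confl E" "i \<in> Arr E" "Dom E i = A" "Cod E i = P" "p \<in> Arr E"
    "Dom E p = P" "Cod E p = X" "p \<cdot> i = hom_zero E A X"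
    using assms(2) by (rule sesE)
  obtain j q where jq: "(j, q) \<in> Confl E" "j \<in> Arr E" "Dom E j = B" "Cod E j = Q" "q \<in> Arr E"
    "Dom E q = Q" "Cod E q = Y" "q \<cdot> j = hom_zero E B Y"
    using assms(3) by (rule sesE)
  have Obj: "X \<in> Obj E" "Y \<in> Obj E" "A \<in> Obj E" "B \<in> Obj E" "P \<in> Obj E" "Q \<in> Obj E"
    using ses_Obj assms(2,3) by blast+
  obtain u1 where u1: "u1 \<in> Arr E" "Dom E u1 = P" "Cod E u1 = Q" "q \<cdot> u1 = u \<cdot> p"
    using projective_liftE[OF assms(4) jq(1), of "u \<cdot> p"] u ip jq by auto
  obtain v1 where v1: "v1 \<in> Arr E" "Dom E v1 = Q" "Cod E v1 = P" "p \<cdot> v1 = v \<cdot> q"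
    using projective_liftE[OF assms(5) ip(1), of "v \<cdot> q"] u ip jq by auto
  obtain h1 where h1: "h1 \<in> Arr E" "Dom E h1 = Cod E g" "Cod E h1 = P" "p \<cdot> h1 = h"
    using projective_liftE[OF gh(1) ip(1), of h] gh ip by auto
  have "q \<cdot> (u1 \<cdot> i) = hom_zero E A Y"
    using u1 u ip jq Obj Comp_reassoc[OF u1(4), of i] by simp
  then obtain u2 where u2: "u2 \<in> Arr E" "Dom E u2 = A" "Cod E u2 = B" "j \<cdot> u2 = u1 \<cdot> i"
    using Confl_kernelE[OF jq(1), of "u1 \<cdot> i"] u1 ip jq by auto
  have "p \<cdot> (v1 \<cdot> j) = hom_zero E B X"
    using v1 u ip jq Obj Comp_reassoc[OF v1(4), of j] by simp
  then obtain v2 where v2: "v2 \<in> Arr E" "Dom E v2 = B" "Cod E v2 = A" "i \<cdot> v2 = v1 \<cdot> j"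
    using Confl_kernelE[OF ip(1), of "v1 \<cdot> j"] v1 ip jq by auto
  \<comment> \<open>Lift to \<open>P\<close> of the decomposition 1 = h g + v u on \<open>X\<close>.
    The first summand lifts because the object between \<open>g\<close> and \<open>h\<close> is
    projective.\<close>
  let ?w = "h1 \<cdot> (g \<cdot> p) \<boxplus> v1 \<cdot> u1"
  have w: "?w \<in> Arr E" "Dom E ?w = P" "Cod E ?w = P"
    using h1 gh ip v1 u1 by simp_all
  have "p \<cdot> ?w = p \<cdot> (h1 \<cdot> (g \<cdot> p)) \<boxplus> p \<cdot> (v1 \<cdot> u1)"
    using h1 gh ip v1 u1 by simp
  also have "p \<cdot> (h1 \<cdot> (g \<cdot> p)) = h \<cdot> (g \<cdot> p)"
    using h1 gh ip Comp_reassoc[OF h1(4), of "g \<cdot> p"] by simp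
  also have "p \<cdot> (v1 \<cdot> u1) = v \<cdot> (u \<cdot> p)"
    using v1 u1 jq ip u Comp_reassoc[OF v1(4), of u1] by simp
  also have "h \<cdot> (g \<cdot> p) \<boxplus> v \<cdot> (u \<cdot> p) = (h \<cdot> g \<boxplus> v \<cdot> u) \<cdot> p"
    using gh(2-6) u ip by simp
  also have "h \<cdot> g \<boxplus> v \<cdot> u = Ident E X" using e(2) gh(7) by simp
  also have "Ident E X \<cdot> p = p" using ip by simp
  finally have pw: "p \<cdot> ?w = p" .
  \<comment> \<open>Since p w = p, the endomorphism 1 - w lands in the kernel \<open>A\<close>; the
    factor \<open>s\<close> supplies the new error term.\<close>
  have "p \<cdot> (Ident E P \<boxplus> hom_neg E ?w) = p \<cdot> Ident E P \<boxplus> hom_neg E (p \<cdot> ?w)"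
    using w ip Obj by (simp del: Comp_hom_add add: Comp_hom_add(1)[of "Ident E P" "hom_neg E ?w"])
  also have "\<dots> = hom_zero E P X" unfolding pw using ip by simp
  finally obtain s where s: "s \<in> Arr E" "Dom E s = P" "Cod E s = A" "i \<cdot> s = Ident E P \<boxplus> hom_neg E ?w"
    using Confl_kernelE[OF ip(1), of "Ident E P \<boxplus> hom_neg E ?w"] w ip Obj by auto
  have "i \<cdot> (s \<cdot> i \<boxplus> v2 \<cdot> u2) = i \<cdot> (s \<cdot> i) \<boxplus> i \<cdot> (v2 \<cdot> u2)"
    using s(1-3) u2(1-3) v2(1-3) ip by simp
  also have "i \<cdot> (s \<cdot> i) = i \<cdot> s \<cdot> i"
    using s(1-3) ip by simp
  also have "i \<cdot> (v2 \<cdot> u2) = v1 \<cdot> (u1 \<cdot> i)"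
    using v2 u2 v1 jq ip Comp_reassoc[OF v2(4), of u2] by simp
  \<comment> \<open>The summand through \<open>g\<close> vanishes on \<open>A\<close> because p i =
    0.\<close>
  also have "v1 \<cdot> (u1 \<cdot> i) = ?w \<cdot> i"
    using h1 gh ip v1 u1 Obj by simp
  also have "i \<cdot> s \<cdot> i \<boxplus> ?w \<cdot> i = (i \<cdot> s \<boxplus> ?w) \<cdot> i"
    using s(1-3) w ip by (intro Comp_hom_add(2)[symmetric]) simp_all
  also have "i \<cdot> s \<boxplus> ?w = Ident E P"
    unfolding s(4) using hom_add_assoc[of "Ident E P" "hom_neg E ?w" ?w] w Obj by simp
  finally have "i \<cdot> (s \<cdot> i \<boxplus> v2 \<cdot> u2) = i \<cdot> Ident E A" using ip Obj by simp
  then have "s \<cdot> i \<boxplus> v2 \<cdot> u2 = Ident E A"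
    by (rule Confl_mono[OF ip(1)]) (use s u2 v2 ip Obj in simp_all)
  moreover have "s \<cdot> i \<in> proj_ideal E A A"
    using s ip assms(4) by (intro proj_idealI[of i s]) simp_all
  ultimately show ?thesis
    using u2 v2 by (intro stable_retractI[of u2 A B v2 "s \<cdot> i"]) simp_all
qed

end

section \<open>Split conflations and the horseshoe\<close>

context exact_category
begin

text \<open>The axioms do not name split sequences as conflations. The cokernel \<open>z\<close> of
  an identity is a zero arrow, and a pullback of two zero arrows is a product; so the projection
  \<open>q\<close> is, up to isomorphism, a base change of the deflation \<open>z\<close>.\<close>

lemma biproduct_ses:
  assumes "is_biproduct E A B D"
  shows "ses E A D B"
proof -
  obtain i j p q where b: "i \<in> Arr E" "Dom E i = A" "Cod E i = D" "j \<in> Arr E" "Dom E j = B" "Cod E j = D"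
    "p \<in> Arr E" "Dom E p = D" "Cod E p = A" "q \<in> Arr E" "Dom E q = D" "Cod E q = B"
    and c: "p \<cdot> i = Ident E A" "q \<cdot> j = Ident E B" "p \<cdot> j = hom_zero E B A" "q \<cdot> i = hom_zero E A B"
    "i \<cdot> p \<boxplus> j \<cdot> q = Ident E D"
    using assms by (rule biproductE)
  have Obj: "A \<in> Obj E" "B \<in> Obj E" "D \<in> Obj E" using b by auto
  obtain z where z: "(Ident E A, z) \<in> Confl E"
    using inflation_Ident[OF Obj(1)] by (auto simp: inflation_def)
  note Z = Confl_simps[OF z]
  let ?o = "hom_zero E B (Cod E z)"
  have z0: "z = hom_zero E A (Cod E z)" using Z Obj by simp
  obtain p' f' where pb: "is_pullback E z ?o p' f'" "deflation E p'"
    using deflation_pullback[of z ?o] z Z Obj by (auto simp: deflation_def)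
  note P = is_pullbackD[OF pb(1)]
  have "z \<cdot> p = hom_zero E A (Cod E z) \<cdot> p" by (rule arg_cong[OF z0, of "\<lambda>x. x \<cdot> p"])
  also have "\<dots> = ?o \<cdot> q" using b Obj Z(2) by simp
  finally have "z \<cdot> p = ?o \<cdot> q" .
  then obtain e where e: "e \<in> Arr E" "Dom E e = D" "Cod E e = Dom E p'" "f' \<cdot> e = p" "p' \<cdot> e = q"
    using is_pullback_liftE[OF pb(1), of p q] b Obj Z by auto
  \<comment> \<open>Inverse of the comparison \<open>e\<close> into the pullback, assembled from the
    injections of the biproduct.\<close>
  let ?d = "i \<cdot> f' \<boxplus> j \<cdot> p'"
  have F: "Cod E f' = A" "Cod E p' = B" using P Z Obj by simp_all
  have d: "?d \<in> Arr E" "Dom E ?d = Dom E p'" "Cod E ?d = D" using b P F by simp_all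
  have "e \<cdot> ?d = Ident E (Dom E p')"
  proof (rule is_pullback_unique[OF pb(1)])
    have "f' \<cdot> (e \<cdot> ?d) = p \<cdot> ?d" using e(1-3) d P Comp_reassoc[OF e(4), of ?d] by simp
    also have "\<dots> = f'"
      using b P F Obj Comp_reassoc[OF c(1), of f'] Comp_reassoc[OF c(3), of p'] by simp
    finally show "f' \<cdot> (e \<cdot> ?d) = f' \<cdot> Ident E (Dom E p')" using P by simp
    have "p' \<cdot> (e \<cdot> ?d) = q \<cdot> ?d" using e(1-3) d P Comp_reassoc[OF e(5), of ?d] by simp
    also have "\<dots> = p'"
      using b P F Obj Comp_reassoc[OF c(4), of f'] Comp_reassoc[OF c(2), of p'] by simp
    finally show "p' \<cdot> (e \<cdot> ?d) = p' \<cdot> Ident E (Dom E p')" using P by simp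
  qed (use e d P in simp_all)
  moreover have "?d \<cdot> e = Ident E D"
    using e b P F c(5) by simp
  ultimately have "is_iso E e"
    using e d by (intro is_isoI[of e D "Dom E p'" ?d]) (simp_all add: in_Hom_iff)
  then have "deflation E q"
    using deflation_iso_Comp[OF pb(2), of e D] e by (simp add: in_Hom_iff)
  moreover have "is_kernel E i q"
  proof (rule is_kernelI)
    fix h assume h: "h \<in> Arr E" "Cod E h = Dom E q" "q \<cdot> h = hom_zero E (Dom E h) (Cod E q)"
    have "h = (i \<cdot> p \<boxplus> j \<cdot> q) \<cdot> h" using c(5) h b by simp
    also have "\<dots> = i \<cdot> (p \<cdot> h)" using h b Obj by simp
    finally show "\<exists>k. k \<in> Arr E \<and> Dom E k = Dom E h \<and> Cod E k = Dom E i \<and> i \<cdot> k = h"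
      using h b by (intro exI[of _ "p \<cdot> h"]) simp
  next
    fix h k assume hk: "i \<cdot> h = i \<cdot> k" "h \<in> Arr E" "k \<in> Arr E" "Dom E h = Dom E k"
      "Cod E h = Dom E i" "Cod E k = Dom E i"
    have "x = p \<cdot> (i \<cdot> x)" if "x \<in> Arr E" "Cod E x = A" for x
      using that b Comp_reassoc[OF c(1), of x] by simp
    from this[of h] this[of k] show "h = k" using hk b by metis
  qed (use b c in simp_all)
  ultimately have "(i, q) \<in> Confl E" by (rule deflation_kernel_Confl)
  then show ?thesis using Confl_ses[of i q] b by simp
qed

text \<open>Since \<open>W\<close> is A \<oplus> P, the wanted \<open>V\<close> is D \<oplus> P. It
  is built as the pullback of D -> A along the retraction of \<open>W\<close> onto \<open>A\<close>,
  which yields the conflation over \<open>W\<close> at once; the work lies in recognising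
  \<open>D\<close> as the kernel of V -> P.\<close>

lemma ses_projective_pullback:
  assumes "ses E A W P" "projective E P" "ses E Z D A"
  obtains V where "ses E D V P" "ses E Z V W"
proof -
  obtain i p where ip: "(i, p) \<in> Confl E" "i \<in> Arr E" "Dom E i = A" "Cod E i = W" "p \<in> Arr E"
    "Dom E p = W" "Cod E p = P" "p \<cdot> i = hom_zero E A P"
    using assms(1) by (rule sesE)
  obtain z \<pi> where z: "(z, \<pi>) \<in> Confl E" "z \<in> Arr E" "Dom E z = Z" "Cod E z = D" "\<pi> \<in> Arr E"
    "Dom E \<pi> = D" "Cod E \<pi> = A" "\<pi> \<cdot> z = hom_zero E Z A"
    using assms(3) by (rule sesE)
  have Obj: "A \<in> Obj E" "W \<in> Obj E" "P \<in> Obj E" "Z \<in> Obj E" "D \<in> Obj E"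
    using ses_Obj[OF assms(1)] ses_Obj[OF assms(3)] by auto
  have "projective E (Cod E p)" using assms(2) ip by simp
  with ip(1) obtain r where r: "r \<in> Arr E" "Dom E r = W" "Cod E r = A" "r \<cdot> i = Ident E A"
    by (rule Confl_splitE) (use ip in auto)
  obtain \<pi>' r' where pb: "is_pullback E \<pi> r \<pi>' r'"
    using deflation_pullback[of \<pi> r] z r by (auto simp: deflation_def)
  note P = is_pullbackD[OF pb]
  obtain z' where z': "(z', \<pi>') \<in> Confl E" "Dom E z' = Z"
    using pullback_Confl[OF pb z(1)] z by metis
  note Z' = Confl_simps[OF z'(1)]
  \<comment> \<open>Cone defining the inclusion of \<open>D\<close> into the pullback: the identity
    of \<open>D\<close> together with D -> A -> W.\<close>
  have "\<pi> \<cdot> Ident E D = r \<cdot> (i \<cdot> \<pi>)"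
    using z r ip Comp_reassoc[OF r(4), of \<pi>] by simp
  then obtain d where d: "d \<in> Arr E" "Dom E d = D" "Cod E d = Dom E \<pi>'" "r' \<cdot> d = Ident E D" "\<pi>' \<cdot> d = i \<cdot> \<pi>"
    using is_pullback_liftE[OF pb, of "Ident E D" "i \<cdot> \<pi>"] z r ip Obj by auto
  have "is_kernel E d (p \<cdot> \<pi>')"
  proof (rule is_kernelI)
    show "p \<cdot> \<pi>' \<cdot> d = hom_zero E (Dom E d) (Cod E (p \<cdot> \<pi>'))"
      using ip z d P r Obj Comp_reassoc[OF ip(8), of \<pi>] by simp
    fix h assume h: "h \<in> Arr E" "Cod E h = Dom E (p \<cdot> \<pi>')"
      "p \<cdot> \<pi>' \<cdot> h = hom_zero E (Dom E h) (Cod E (p \<cdot> \<pi>'))"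
    then have h': "Cod E h = Dom E \<pi>'" "p \<cdot> (\<pi>' \<cdot> h) = hom_zero E (Dom E h) P"
      using ip P r by simp_all
    obtain a where a: "a \<in> Arr E" "Dom E a = Dom E h" "Cod E a = A" "i \<cdot> a = \<pi>' \<cdot> h"
      using Confl_kernelE[OF ip(1), of "\<pi>' \<cdot> h"] ip P r h(1) h' by auto
    \<comment> \<open>If \<open>h\<close> dies in \<open>P\<close>, its \<open>W\<close>-component
      lies in \<open>A\<close>; the retraction recovers that component, and
      \<open>r' \<cdot> h\<close> alone determines \<open>h\<close>.\<close>
    have "a = r \<cdot> (i \<cdot> a)" using r ip a(1-3) Comp_reassoc[OF r(4), of a] by simp
    also have "\<dots> = \<pi> \<cdot> (r' \<cdot> h)" unfolding a(4)
      using P r z h(1) h' Comp_reassoc[OF P(9), of h] by simp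
    finally have a': "a = \<pi> \<cdot> (r' \<cdot> h)" .
    have "d \<cdot> (r' \<cdot> h) = h"
    proof (rule is_pullback_unique[OF pb])
      show "r' \<cdot> (d \<cdot> (r' \<cdot> h)) = r' \<cdot> h"
        using d P z h(1) h' Comp_reassoc[OF d(4), of "r' \<cdot> h"] by simp
      have "\<pi>' \<cdot> (d \<cdot> (r' \<cdot> h)) = i \<cdot> \<pi> \<cdot> (r' \<cdot> h)"
        using d P z h(1) h' Comp_reassoc[OF d(5), of "r' \<cdot> h"] by simp
      also have "\<dots> = i \<cdot> a" unfolding a' using ip z P h(1) h' by simp
      finally show "\<pi>' \<cdot> (d \<cdot> (r' \<cdot> h)) = \<pi>' \<cdot> h" unfolding a(4) .
    qed (use d P z h(1) h' in simp_all)
    then show "\<exists>k. k \<in> Arr E \<and> Dom E k = Dom E h \<and> Cod E k = Dom E d \<and> d \<cdot> k = h"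
      using d P z h(1) h' by (intro exI[of _ "r' \<cdot> h"]) simp
  next
    fix h k assume hk: "d \<cdot> h = d \<cdot> k" "h \<in> Arr E" "k \<in> Arr E" "Dom E h = Dom E k"
      "Cod E h = Dom E d" "Cod E k = Dom E d"
    have "x = r' \<cdot> (d \<cdot> x)" if "x \<in> Arr E" "Cod E x = D" for x
      using that d P z Comp_reassoc[OF d(4), of x] by simp
    from this[of h] this[of k] show "h = k" using hk d by metis
  qed (use d ip P r in simp_all)
  moreover have "deflation E (p \<cdot> \<pi>')"
    using deflation_Comp[of \<pi>' p] z' ip P r by (auto simp: deflation_def)
  ultimately have "(d, p \<cdot> \<pi>') \<in> Confl E" by (intro deflation_kernel_Confl)
  from Confl_ses[OF this] have "ses E D (Dom E \<pi>') P" using d ip P r by simp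
  moreover have "ses E Z (Dom E \<pi>') W" using Confl_ses[OF z'(1)] z' Z' P r by simp
  ultimately show ?thesis using that by blast
qed

text \<open>\<open>V\<close> lies over the pullback \<open>W\<close> of \<open>B\<close> and
  \<open>P\<close>; the composite V -> W -> B is a deflation whose kernel \<open>K\<close> is
  filtered by \<open>Z\<close> and \<open>G\<close>. It is applied with \<open>D\<close> projective,
  where \<open>K\<close> is a syzygy of \<open>B\<close>, and with \<open>D\<close> the middle term
  of a resolution step of \<open>A\<close>.\<close>

lemma ses_horseshoe:
  assumes "ses E A B C" "ses E Z D A" "ses E G P C" "projective E P"
  obtains V K where "ses E D V P" "ses E Z K G" "ses E K V B"
proof -
  obtain W where W: "ses E G W B" "ses E A W P" using ses_pullback[OF assms(1,3)] .
  obtain V where V: "ses E D V P" "ses E Z V W"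
    using ses_projective_pullback[OF W(2) assms(4,2)] .
  obtain K where "ses E Z K G" "ses E K V B" using ses_comp[OF V(2) W(1)] .
  then show ?thesis using that V by blast
qed

end

section \<open>Finite derived delooping level\<close>

locale exact_category_with_syzygies = exact_category E
  for E :: "('o, 'm, 'z) exact_cat_scheme" (structure) +
  fixes S :: "'o \<Rightarrow> 'm \<times> 'm"
  assumes syzygy_choice: "syzygy_choice E S"
begin

lemma syzygy_sesE:
  assumes "X \<in> Obj E"
  obtains P where "projective E P" "ses E (syzygy E S X) P X"
proof -
  have "(fst (S X), snd (S X)) \<in> Confl E" "projective E (Dom E (snd (S X)))" "Cod E (snd (S X)) = X"
    using syzygy_choice assms by (simp_all add: syzygy_choice_def)
  then show ?thesis using that Confl_ses[of "fst (S X)" "snd (S X)"] Confl_simps(3)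
    unfolding syzygy_def by metis
qed

lemma syzygy_Obj: "X \<in> Obj E \<Longrightarrow> syzygy E S X \<in> Obj E"
  using syzygy_sesE ses_Obj by metis

lemma syzygy_funpow_Obj: "X \<in> Obj E \<Longrightarrow> (syzygy E S ^^ n) X \<in> Obj E"
  by (induction n) (simp_all add: syzygy_Obj)

lemma stable_retract_syzygy_choice:
  assumes "stable_retract E X Y"
  shows "stable_retract E (syzygy E S X) (syzygy E S Y)"
proof -
  obtain P where P: "projective E P" "ses E (syzygy E S X) P X"
    using syzygy_sesE stable_retract_Obj[OF assms] by blast
  obtain Q where Q: "projective E Q" "ses E (syzygy E S Y) Q Y"
    using syzygy_sesE stable_retract_Obj[OF assms] by blast
  show ?thesis using stable_retract_syzygy[OF assms P(2) Q(2) P(1) Q(1)] .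
qed

lemma stable_retract_syzygy_funpow:
  "stable_retract E X Y \<Longrightarrow> stable_retract E ((syzygy E S ^^ n) X) ((syzygy E S ^^ n) Y)"
  by (induction n) (simp_all add: stable_retract_syzygy_choice)

lemma dell_finite_iff:
  "dell E S k X < \<infinity> \<longleftrightarrow>
     (\<exists>n. \<exists>Y \<in> Obj E. stable_retract E ((syzygy E S ^^ n) X) ((syzygy E S ^^ (n + k)) Y))"
  unfolding dell_def Inf_less_iff by auto

lemma dell_finite_retract:
  assumes "dell E S k Y < \<infinity>" "stable_retract E X Y"
  shows "dell E S k X < \<infinity>"
  using assms stable_retract_trans[OF stable_retract_syzygy_funpow] unfolding dell_finite_iff by blast

text \<open>The same \<open>n\<close> and \<open>Y\<close> witness the next level after one more
  syzygy. Comparison with the chosen syzygy admits any conflation with projective middle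
  term.\<close>

lemma dell_finite_syzygy:
  assumes "dell E S k X < \<infinity>" "ses E A P X" "projective E P"
  shows "dell E S (Suc k) A < \<infinity>"
proof -
  have X: "X \<in> Obj E" using ses_Obj[OF assms(2)] by simp
  obtain Q where Q: "projective E Q" "ses E (syzygy E S X) Q X" using syzygy_sesE[OF X] .
  obtain n Y where Y: "Y \<in> Obj E" "stable_retract E ((syzygy E S ^^ n) X) ((syzygy E S ^^ (n + k)) Y)"
    using assms(1) unfolding dell_finite_iff by blast
  from stable_retract_syzygy_choice[OF Y(2)]
  have "stable_retract E ((syzygy E S ^^ n) (syzygy E S X)) ((syzygy E S ^^ (n + Suc k)) Y)"
    by (simp add: funpow_swap1)
  then have "dell E S (Suc k) (syzygy E S X) < \<infinity>" unfolding dell_finite_iff using Y by blast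
  moreover have "stable_retract E A (syzygy E S X)"
    using stable_retract_syzygy[OF stable_retract_refl[OF X] assms(2) Q(2) assms(3) Q(1)] .
  ultimately show ?thesis by (rule dell_finite_retract)
qed

lemma dell_finite_projective:
  assumes "projective E P"
  shows "dell E S k P < \<infinity>"
proof -
  have "P \<in> Obj E" by (rule projective_Obj) fact
  then have "stable_retract E ((syzygy E S ^^ 0) P) ((syzygy E S ^^ (0 + k)) P)"
    using assms projective_stable_retract syzygy_funpow_Obj by simp
  then show ?thesis unfolding dell_finite_iff using \<open>P \<in> Obj E\<close> by blast
qed

text \<open>With n = 0 and Y = X as witnesses, level 0 imposes no condition; the index shift in
  \<open>finite_ddell_subobject\<close> starts from here.\<close>

lemma dell_zero_finite: "X \<in> Obj E \<Longrightarrow> dell E S 0 X < \<infinity>"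
  unfolding dell_finite_iff using stable_retract_refl by (intro exI[of _ 0] bexI[of _ X]) simp_all

text \<open>The level rises with each step because the term in position i of a resolution is tested
  at level i + k. Numerical bounds are dropped and recovered in
  \<open>finite_ddell_imp\<close>.\<close>

inductive finite_ddell :: "nat \<Rightarrow> 'o \<Rightarrow> bool" where
  base: "\<lbrakk>X \<in> Obj E; dell E S k X < \<infinity>\<rbrakk> \<Longrightarrow> finite_ddell k X"
| step: "\<lbrakk>ses E Z C X; dell E S k C < \<infinity>; finite_ddell (Suc k) Z\<rbrakk> \<Longrightarrow> finite_ddell k X"

section \<open>Closure properties of the inductive predicate\<close>

lemma finite_ddell_Obj: "finite_ddell k X \<Longrightarrow> X \<in> Obj E"
  by (cases rule: finite_ddell.cases) (auto dest: ses_Obj)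

lemma finite_ddell_projective: "projective E P \<Longrightarrow> finite_ddell k P"
  by (intro finite_ddell.base projective_Obj dell_finite_projective)

text \<open>The summand \<open>P\<close> is cut off at the first term of the resolution: the kernel
  \<open>M\<close> of C -> W -> P maps onto \<open>A\<close> with the same kernel \<open>Z\<close>,
  and it differs from \<open>C\<close> only by the projective \<open>P\<close>.\<close>

lemma finite_ddell_projective_kernel:
  assumes "finite_ddell k W" "ses E A W P" "projective E P"
  shows "finite_ddell k A"
  using assms
proof (cases rule: finite_ddell.cases)
  case base
  have "dell E S k A < \<infinity>"
    by (rule dell_finite_retract[OF base(2) ses_projective_stable_retract(2)[OF assms(2,3)]])
  then show ?thesis using ses_Obj[OF assms(2)] by (intro finite_ddell.base) simp_all
next
  case (step Z C)
  obtain M where M: "ses E Z M A" "ses E M C P" using ses_comp[OF step(1) assms(2)] .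
  have "dell E S k M < \<infinity>"
    by (rule dell_finite_retract[OF step(2) ses_projective_stable_retract(2)[OF M(2) assms(3)]])
  with M(1) show ?thesis using step(3) by (rule finite_ddell.step)
qed

text \<open>Fed with projectives over both ends, the horseshoe has an extension of projectives as
  \<open>V\<close>, so \<open>K\<close> is a syzygy of \<open>C\<close>; the induction hypothesis
  applies to the chosen syzygy of \<open>Z\<close>.\<close>

lemma finite_ddell_syzygy:
  assumes "finite_ddell k X" "ses E A P X" "projective E P"
  shows "finite_ddell (Suc k) A"
  using assms
proof (induction arbitrary: A P)
  case (base X k)
  have "dell E S (Suc k) A < \<infinity>" using dell_finite_syzygy[OF base.hyps(2) base.prems] .
  then show ?case using ses_Obj[OF base.prems(1)] by (intro finite_ddell.base) simp_all
next
  case (step Z C X k)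
  obtain Q where Q: "projective E Q" "ses E (syzygy E S Z) Q Z"
    using syzygy_sesE finite_ddell_Obj[OF step.hyps(3)] by blast
  obtain V K where V: "ses E Q V P" "ses E (syzygy E S Z) K A" "ses E K V C"
    using ses_horseshoe[OF step.hyps(1) Q(2) step.prems] .
  have "projective E V" using ses_projective[OF V(1) Q(1) step.prems(2)] .
  then have "dell E S (Suc k) K < \<infinity>" using dell_finite_syzygy[OF step.hyps(2) V(3)] by simp
  moreover have "finite_ddell (Suc (Suc k)) (syzygy E S Z)" using step.IH[OF Q(2,1)] .
  ultimately show ?case by (rule finite_ddell.step[OF V(2)])
qed

text \<open>The right-hand term enters only through its syzygy, one level up. In the base case that
  syzygy is itself the kernel over \<open>B\<close>; in the step case the kernel is an extension of
  it by \<open>Z\<close>, so the hypothesis for \<open>Z\<close> applies at level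
  \<open>Suc k\<close> with a new right-hand term.\<close>

lemma finite_ddell_extension:
  assumes "finite_ddell k A" "finite_ddell k C" "ses E A B C"
  shows "finite_ddell k B"
  using assms
proof (induction arbitrary: B C)
  case (base A k)
  obtain P where P: "projective E P" "ses E (syzygy E S C) P C"
    using syzygy_sesE finite_ddell_Obj[OF base.prems(1)] by blast
  obtain W where W: "ses E (syzygy E S C) W B" "ses E A W P" using ses_pullback[OF base.prems(2) P(2)] .
  \<comment> \<open>\<open>W\<close> is A \<oplus> P, hence a stable retract of
    \<open>A\<close>.\<close>
  have "dell E S k W < \<infinity>"
    by (rule dell_finite_retract[OF base.hyps(2) ses_projective_stable_retract(1)[OF W(2) P(1)]])
  with W(1) show ?case
    using finite_ddell_syzygy[OF base.prems(1) P(2,1)] by (rule finite_ddell.step)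
next
  case (step Z D A k)
  obtain P where P: "projective E P" "ses E (syzygy E S C) P C"
    using syzygy_sesE finite_ddell_Obj[OF step.prems(1)] by blast
  obtain V K where V: "ses E D V P" "ses E Z K (syzygy E S C)" "ses E K V B"
    using ses_horseshoe[OF step.prems(2) step.hyps(1) P(2,1)] .
  have "dell E S k V < \<infinity>"
    by (rule dell_finite_retract[OF step.hyps(2) ses_projective_stable_retract(1)[OF V(1) P(1)]])
  moreover have "finite_ddell (Suc k) K"
    using step.IH[OF finite_ddell_syzygy[OF step.prems(1) P(2,1)] V(2)] .
  ultimately show ?case by (rule finite_ddell.step[OF V(3)])
qed

text \<open>The syzygy of \<open>Q\<close> must share the level of \<open>Y\<close>, so
  \<open>Q\<close> must sit one level below; for level 1 this is automatic.\<close>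

lemma finite_ddell_subobject:
  assumes "finite_ddell 1 Y" "ses E X Y Q"
  shows "finite_ddell 1 X"
proof -
  have Q: "Q \<in> Obj E" using ses_Obj[OF assms(2)] by simp
  obtain P where P: "projective E P" "ses E (syzygy E S Q) P Q" using syzygy_sesE[OF Q] .
  obtain W where W: "ses E (syzygy E S Q) W Y" "ses E X W P" using ses_pullback[OF assms(2) P(2)] .
  have "finite_ddell 0 Q" using Q dell_zero_finite by (intro finite_ddell.base)
  then have "finite_ddell 1 (syzygy E S Q)" using finite_ddell_syzygy[OF _ P(2,1)] by simp
  then have "finite_ddell 1 W" using finite_ddell_extension[OF _ assms(1) W(1)] by simp
  then show ?thesis using finite_ddell_projective_kernel[OF _ W(2) P(1)] by simp
qed

section \<open>Comparison with the resolutions in the definition of \<open>ddell\<close>\<close>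

lemma finite_ddell_resolutionE:
  assumes "finite_ddell k X"
  obtains t Z C \<iota> \<pi> where "Z 0 = X" "Z t = C t"
    "\<And>i. i < t \<Longrightarrow> (\<iota> i, \<pi> i) \<in> Confl E \<and> \<iota> i \<in> Hom E (Z (Suc i)) (C i) \<and> \<pi> i \<in> Hom E (C i) (Z i)"
    "\<And>i. i \<le> t \<Longrightarrow> dell E S (i + k) (C i) < \<infinity>"
  using assms
proof (induction arbitrary: thesis)
  case (base X k)
  show ?case by (rule base.prems[of "\<lambda>_. X" 0 "\<lambda>_. X"]) (use base.hyps in simp_all)
next
  case (step Z' C' X k)
  obtain t Z C \<iota> \<pi> where r: "Z 0 = Z'" "Z t = C t"
    "\<And>i. i < t \<Longrightarrow> (\<iota> i, \<pi> i) \<in> Confl E \<and> \<iota> i \<in> Hom E (Z (Suc i)) (C i) \<and> \<pi> i \<in> Hom E (C i) (Z i)"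
    "\<And>i. i \<le> t \<Longrightarrow> dell E S (i + Suc k) (C i) < \<infinity>"
    using step.IH by metis
  obtain i p where ip: "(i, p) \<in> Confl E" "i \<in> Hom E Z' C'" "p \<in> Hom E C' X"
    using step.hyps(1) unfolding ses_def by blast
  \<comment> \<open>Prepending the conflation shifts every position by one; level
    \<open>i + Suc k\<close> in the tail is level \<open>Suc i + k\<close> in the whole.\<close>
  show ?case
    by (rule step.prems[of "case_nat X Z" "Suc t" "case_nat C' C" "case_nat i \<iota>" "case_nat p \<pi>"])
       (use r ip step.hyps(2) in \<open>auto split: nat.splits\<close>)
qed

lemma ddell_finite_imp:
  assumes "X \<in> Obj E" "ddell E S k X < \<infinity>"
  shows "finite_ddell k X"
proof -
  obtain m t C d where t: "t \<le> m" "admissibly_exact E t C d X"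
    and le: "\<forall>i\<le>t. dell E S (i + k) (C i) \<le> enat (m - i)"
    using assms(2) unfolding ddell_def Inf_less_iff by blast
  have fin: "dell E S (i + k) (C i) < \<infinity>" if "i \<le> t" for i
    by (rule le_less_trans[OF le[rule_format, OF that]]) simp
  show "finite_ddell k X"
  proof (cases "t = 0")
    case True
    \<comment> \<open>\<open>C 0\<close> is only isomorphic to \<open>X\<close>; the isomorphism is
      used as a retraction, along which finiteness of dell is inherited.\<close>
    then have "d 0 \<in> Hom E (C 0) X" "is_iso E (d 0)"
      using t(2) by (simp_all add: admissibly_exact_def)
    then obtain g where "g \<in> Hom E X (C 0)" "d 0 \<cdot> g = Ident E X"
      by (auto simp: is_iso_def in_Hom_iff)
    with \<open>d 0 \<in> Hom E (C 0) X\<close> have "is_retract E X (C 0)" unfolding is_retract_def by blast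
    then have "stable_retract E X (C 0)" by (rule retract_stable_retract)
    then have "dell E S k X < \<infinity>" by (rule dell_finite_retract[rotated]) (use fin[of 0] in simp)
    with assms(1) show ?thesis by (rule finite_ddell.base)
  next
    case False
    then obtain Z \<iota> \<pi> where Z: "Z 0 = X" "Z t = C t"
      "\<And>i. i < t \<Longrightarrow> (\<iota> i, \<pi> i) \<in> Confl E \<and> \<iota> i \<in> Hom E (Z (Suc i)) (C i) \<and> \<pi> i \<in> Hom E (C i) (Z i)"
      using t(2) unfolding admissibly_exact_def if_not_P[OF False] by blast
    have ses: "ses E (Z (Suc i)) (C i) (Z i)" if "i < t" for i
      using Z(3)[OF that] unfolding ses_def by blast
    \<comment> \<open>Downward induction from the last kernel \<open>Z t\<close>, which is
      \<open>C t\<close> and enters through the base rule.\<close>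
    have "finite_ddell (i + k) (Z i)" if "i \<le> t" for i
      using that
    proof (induction rule: inc_induct)
      case base
      \<comment> \<open>As t > 0, \<open>C t\<close> is the left-hand term of the conflation in
        position t - 1.\<close>
      have "C t \<in> Obj E" using ses_Obj[OF ses[of "t - 1"]] False Z(2) by simp
      then show ?case using fin[of t] Z(2) by (intro finite_ddell.base) simp_all
    next
      case (step i)
      have "ses E (Z (Suc i)) (C i) (Z i)" using step.hyps ses by simp
      moreover have "dell E S (i + k) (C i) < \<infinity>" using step.hyps fin by simp
      moreover have "finite_ddell (Suc (i + k)) (Z (Suc i))" using step.IH by simp
      ultimately show ?case by (rule finite_ddell.step)
    qed
    from this[of 0] show ?thesis using Z by simp
  qed
qed

lemma finite_ddell_imp:
  assumes "finite_ddell k X"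
  shows "ddell E S k X < \<infinity>"
proof -
  obtain t Z C \<iota> \<pi> where Z: "Z 0 = X" "Z t = C t"
    "\<And>i. i < t \<Longrightarrow> (\<iota> i, \<pi> i) \<in> Confl E \<and> \<iota> i \<in> Hom E (Z (Suc i)) (C i) \<and> \<pi> i \<in> Hom E (C i) (Z i)"
    and fin: "\<And>i. i \<le> t \<Longrightarrow> dell E S (i + k) (C i) < \<infinity>"
    using assms by (rule finite_ddell_resolutionE) blast
  define b where "b i = the_enat (dell E S (i + k) (C i))" for i
  \<comment> \<open>The bound demanded in position i is m - i, which is smallest for i = t; adding t
    to the largest dell meets all of them.\<close>
  define m where "m = t + Max (b ` {..t})"
  have "dell E S (i + k) (C i) \<le> enat (m - i)" if "i \<le> t" for i
  proof -
    have "dell E S (i + k) (C i) = enat (b i)" using fin[OF that] unfolding b_def by auto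
    moreover have "b i \<le> Max (b ` {..t})" using that by simp
    then have "b i \<le> m - i" using that unfolding m_def by linarith
    ultimately show ?thesis by simp
  qed
  moreover have "\<exists>d. admissibly_exact E t C d X"
  proof (cases "t = 0")
    case True
    then have "admissibly_exact E t C (\<lambda>_. Ident E X) X"
      using Z finite_ddell_Obj[OF assms] by (simp add: admissibly_exact_def in_Hom_iff is_iso_Ident)
    then show ?thesis by blast
  next
    case False
    \<comment> \<open>The last differential has no deflation factor because the kernel
      \<open>Z t\<close> is \<open>C t\<close> itself.\<close>
    define d where "d i = (if i = 0 then \<pi> 0 else if i = t then \<iota> (t - 1) else \<iota> (i - 1) \<cdot> \<pi> i)" for i
    have "\<exists>Z \<iota> \<pi>. Z 0 = X \<and> Z t = C t \<and>
        (\<forall>i<t. (\<iota> i, \<pi> i) \<in> Confl E \<and> \<iota> i \<in> Hom E (Z (Suc i)) (C i) \<and> \<pi> i \<in> Hom E (C i) (Z i)) \<and>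
        d 0 = \<pi> 0 \<and> (\<forall>i. Suc i < t \<longrightarrow> d (Suc i) = \<iota> i \<cdot> \<pi> (Suc i)) \<and> d t = \<iota> (t - 1)"
      by (rule exI[of _ Z], rule exI[of _ \<iota>], rule exI[of _ \<pi>])
         (use Z(1,2) False in \<open>simp add: Z(3) d_def\<close>)
    then have "admissibly_exact E t C d X" by (simp only: admissibly_exact_def False if_False)
    then show ?thesis by blast
  qed
  moreover have "t \<le> m" by (simp add: m_def)
  ultimately have "ddell E S k X \<le> enat m"
    unfolding ddell_def by (intro Inf_lower) blast
  then show "ddell E S k X < \<infinity>" by (rule le_less_trans) simp
qed

lemma Fddell_iff: "X \<in> Fddell E S \<longleftrightarrow> finite_ddell 1 X"
  unfolding Fddell_def using ddell_finite_imp finite_ddell_imp finite_ddell_Obj by blast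

end

section \<open>Extension-closed subcategories\<close>

lemma full_exact_subcategory_simps [simp]:
  "Obj (full_exact_subcategory E F) = F"
  "Dom (full_exact_subcategory E F) = Dom E"
  "Cod (full_exact_subcategory E F) = Cod E"
  "Ident (full_exact_subcategory E F) = Ident E"
  "Comp (full_exact_subcategory E F) = Comp E"
  "hom_add (full_exact_subcategory E F) = hom_add E"
  "hom_zero (full_exact_subcategory E F) = hom_zero E"
  "f \<in> Arr (full_exact_subcategory E F) \<longleftrightarrow> f \<in> Arr E \<and> Dom E f \<in> F \<and> Cod E f \<in> F"
  "(i, p) \<in> Confl (full_exact_subcategory E F) \<longleftrightarrow>
     (i, p) \<in> Confl E \<and> Dom E i \<in> F \<and> Cod E i \<in> F \<and> Cod E p \<in> F"
  by (simp_all add: full_exact_subcategory_def)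

lemma full_exact_subcategory_Hom:
  "f \<in> Hom (full_exact_subcategory E F) X Y \<longleftrightarrow> f \<in> Hom E X Y \<and> X \<in> F \<and> Y \<in> F"
  by (auto simp: Hom_def)

lemma full_exact_subcategory_is_iso:
  assumes "is_iso (full_exact_subcategory E F) f"
  shows "is_iso E f"
  using assms by (auto simp: is_iso_def full_exact_subcategory_Hom)

context exact_category
begin

lemma full_exact_subcategory_is_pushout:
  assumes "is_pushout E i f i' f'" "Dom E i \<in> F" "Cod E i \<in> F" "Cod E f \<in> F" "Cod E i' \<in> F"
  shows "is_pushout (full_exact_subcategory E F) i f i' f'"
proof -
  note P = is_pushoutD[OF assms(1)]
  have ex: "\<exists>!c. c \<in> Hom (full_exact_subcategory E F) (Cod E i') T \<and> c \<cdot> f' = a \<and> c \<cdot> i' = b"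
    if "a \<in> Hom (full_exact_subcategory E F) (Cod E i) T"
      "b \<in> Hom (full_exact_subcategory E F) (Cod E f) T" "a \<cdot> i = b \<cdot> f" for T a b
    using is_pushout_ex1[OF assms(1), of a b] that assms(5)
    by (simp add: full_exact_subcategory_Hom in_Hom_iff)
  show ?thesis
    unfolding is_pushout_def full_exact_subcategory_simps
    by (intro conjI allI ballI impI ex)
       (use P assms(2-) in \<open>simp_all add: full_exact_subcategory_Hom in_Hom_iff\<close>)
qed

lemma full_exact_subcategory_is_pullback:
  assumes "is_pullback E p f p' f'" "Dom E p \<in> F" "Cod E p \<in> F" "Dom E f \<in> F" "Dom E p' \<in> F"
  shows "is_pullback (full_exact_subcategory E F) p f p' f'"
proof -
  note P = is_pullbackD[OF assms(1)]
  have ex: "\<exists>!c. c \<in> Hom (full_exact_subcategory E F) T (Dom E p') \<and> f' \<cdot> c = a \<and> p' \<cdot> c = b"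
    if "a \<in> Hom (full_exact_subcategory E F) T (Dom E p)"
      "b \<in> Hom (full_exact_subcategory E F) T (Dom E f)" "p \<cdot> a = f \<cdot> b" for T a b
    using is_pullback_ex1[OF assms(1), of a b] that assms(5)
    by (simp add: full_exact_subcategory_Hom in_Hom_iff)
  show ?thesis
    unfolding is_pullback_def full_exact_subcategory_simps
    by (intro conjI allI ballI impI ex)
       (use P assms(2-) in \<open>simp_all add: full_exact_subcategory_Hom in_Hom_iff\<close>)
qed

lemma closed_under_extensionsD: "closed_under_extensions E F \<Longrightarrow> ses E A B C \<Longrightarrow> A \<in> F \<Longrightarrow> C \<in> F \<Longrightarrow> B \<in> F"
  unfolding closed_under_extensions_def by (elim sesE) fastforce

text \<open>\<open>inflation_Ident\<close> and \<open>deflation_Ident\<close> leave the other map of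
  the conflation unspecified. Here its outer end is the given zero object, so the conflation stays
  in any full subcategory containing \<open>X\<close> and that object.\<close>

lemma zero_Confl:
  assumes "is_zero_object E Z" "X \<in> Obj E"
  shows "(Ident E X, hom_zero E X Z) \<in> Confl E" "(hom_zero E Z X, Ident E X) \<in> Confl E"
proof -
  have Z: "Z \<in> Obj E" using assms(1) by (simp add: is_zero_object_def)
  note hom0 = zero_object_Hom[OF assms(1), unfolded in_Hom_iff]
  have "is_cokernel E (hom_zero E X Z) (Ident E X)"
  proof (rule is_cokernelI)
    fix h assume "h \<in> Arr E" "Dom E h = Cod E (Ident E X)"
      "h \<cdot> Ident E X = hom_zero E (Dom E (Ident E X)) (Cod E h)"
    then show "\<exists>k. k \<in> Arr E \<and> Dom E k = Cod E (hom_zero E X Z) \<and> Cod E k = Cod E h \<and>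
        k \<cdot> hom_zero E X Z = h"
      using assms(2) Z by (intro exI[of _ "hom_zero E Z (Cod E h)"]) simp
  next
    fix h k assume "h \<in> Arr E" "k \<in> Arr E" "Cod E h = Cod E k"
      "Dom E h = Cod E (hom_zero E X Z)" "Dom E k = Cod E (hom_zero E X Z)"
    then show "h = k" using hom0(1)[of h "Cod E k"] hom0(1)[of k "Cod E k"] assms(2) Z by simp
  qed (use assms Z in simp_all)
  then show "(Ident E X, hom_zero E X Z) \<in> Confl E"
    by (rule inflation_cokernel_Confl[OF inflation_Ident[OF assms(2)]])
  have "is_kernel E (hom_zero E Z X) (Ident E X)"
  proof (rule is_kernelI)
    fix h assume "h \<in> Arr E" "Cod E h = Dom E (Ident E X)"
      "Ident E X \<cdot> h = hom_zero E (Dom E h) (Cod E (Ident E X))"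
    then show "\<exists>k. k \<in> Arr E \<and> Dom E k = Dom E h \<and> Cod E k = Dom E (hom_zero E Z X) \<and>
        hom_zero E Z X \<cdot> k = h"
      using assms(2) Z by (intro exI[of _ "hom_zero E (Dom E h) Z"]) simp
  next
    fix h k assume "h \<in> Arr E" "k \<in> Arr E" "Dom E h = Dom E k"
      "Cod E h = Dom E (hom_zero E Z X)" "Cod E k = Dom E (hom_zero E Z X)"
    then show "h = k" using hom0(2)[of h "Dom E k"] hom0(2)[of k "Dom E k"] assms(2) Z by simp
  qed (use assms Z in simp_all)
  then show "(hom_zero E Z X, Ident E X) \<in> Confl E"
    by (rule deflation_kernel_Confl[OF deflation_Ident[OF assms(2)]])
qed

lemma Confl_full_exact_subcategory:
  assumes "(i, p) \<in> Confl (full_exact_subcategory E F)"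
  shows "kernel_cokernel_pair (full_exact_subcategory E F) i p"
proof -
  have ip: "(i, p) \<in> Confl E" "Dom E i \<in> F" "Cod E i \<in> F" "Cod E p \<in> F" using assms by simp_all
  note C = Confl_simps[OF ip(1)]
  show ?thesis
    unfolding kernel_cokernel_pair_def is_kernel_def is_cokernel_def
  proof (intro conjI allI ballI impI)
    fix T h
    assume "h \<in> Hom (full_exact_subcategory E F) T (Dom (full_exact_subcategory E F) p)"
      "p \<cdot>\<^bsub>full_exact_subcategory E F\<^esub> h =
        hom_zero (full_exact_subcategory E F) T (Cod (full_exact_subcategory E F) p)"
    then have h: "h \<in> Hom E T (Dom E p)" "p \<cdot> h = hom_zero E T (Cod E p)" "T \<in> F"
      by (simp_all add: full_exact_subcategory_Hom)
    then have "\<exists>!k. k \<in> Hom E T (Dom E i) \<and> i \<cdot> k = h"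
      using Confl_kernel[OF ip(1)] unfolding is_kernel_def by blast
    then show "\<exists>!k. k \<in> Hom (full_exact_subcategory E F) T (Dom (full_exact_subcategory E F) i) \<and>
        i \<cdot>\<^bsub>full_exact_subcategory E F\<^esub> k = h"
      using h ip by (simp add: full_exact_subcategory_Hom)
  next
    fix T h
    assume "h \<in> Hom (full_exact_subcategory E F) (Cod (full_exact_subcategory E F) i) T"
      "h \<cdot>\<^bsub>full_exact_subcategory E F\<^esub> i =
        hom_zero (full_exact_subcategory E F) (Dom (full_exact_subcategory E F) i) T"
    then have h: "h \<in> Hom E (Cod E i) T" "h \<cdot> i = hom_zero E (Dom E i) T" "T \<in> F"
      by (simp_all add: full_exact_subcategory_Hom)
    then have "\<exists>!k. k \<in> Hom E (Cod E p) T \<and> k \<cdot> p = h"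
      using Confl_cokernel[OF ip(1)] unfolding is_cokernel_def by blast
    then show "\<exists>!k. k \<in> Hom (full_exact_subcategory E F) (Cod (full_exact_subcategory E F) p) T \<and>
        k \<cdot>\<^bsub>full_exact_subcategory E F\<^esub> p = h"
      using h ip by (simp add: full_exact_subcategory_Hom)
  qed (use ip C in simp_all)
qed

text \<open>Every object that the axioms create is the middle term of a conflation with ends in
  \<open>F\<close>: a biproduct, the new vertex of a pushout or pullback, the kernel or cokernel of
  a composite. Constructions are made in \<open>E\<close>, and fullness restricts their universal
  properties.\<close>

lemma exact_full_exact_subcategory:
  assumes F: "F \<subseteq> Obj E" and ext: "closed_under_extensions E F"
    and Z: "is_zero_object E Z" "Z \<in> F"
  shows "exact_category (full_exact_subcategory E F)"
proof -
  let ?F = "full_exact_subcategory E F"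
  note Hom_iff = full_exact_subcategory_Hom
  have cat: "category ?F"
    by unfold_locales (use F in \<open>auto simp: Hom_iff in_Hom_iff\<close>)
  have preadd: "preadditive_category ?F"
  proof (intro preadditive_category.intro preadditive_category_axioms.intro cat)
    show "comm_group (hom_group ?F X Y)" if "X \<in> Obj ?F" "Y \<in> Obj ?F" for X Y
    proof -
      have "hom_group ?F X Y = hom_group E X Y"
        using that by (auto simp: hom_group_def Hom_iff)
      then show ?thesis using that F hom_comm_group by auto
    qed
  qed (auto simp: Hom_iff in_Hom_iff)
  have add: "additive_category ?F"
  proof (intro additive_category.intro additive_category_axioms.intro preadd)
    have "is_zero_object ?F Z"
      using Z F unfolding is_zero_object_def by (simp add: Hom_iff subset_iff)
    then show "\<exists>Z. is_zero_object ?F Z" ..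
    fix A B assume AB: "A \<in> Obj ?F" "B \<in> Obj ?F"
    then obtain D where D: "is_biproduct E A B D"
      using biproduct_exists F by (metis full_exact_subcategory_simps(1) subsetD)
    then have "D \<in> F" using closed_under_extensionsD[OF ext biproduct_ses[OF D]] AB by simp
    moreover have "is_biproduct ?F A B D"
      using D AB \<open>D \<in> F\<close> unfolding is_biproduct_def Bex_def Hom_iff by simp
    ultimately show "\<exists>D \<in> Obj ?F. is_biproduct ?F A B D" by auto
  qed
  show ?thesis
  proof (intro exact_category.intro exact_category_axioms.intro add)
    show "kernel_cokernel_pair ?F i p" if "(i, p) \<in> Confl ?F" for i p
      using that by (rule Confl_full_exact_subcategory)
    show "(i', p') \<in> Confl ?F"
      if "(i, p) \<in> Confl ?F" "i' \<in> Hom ?F A' B'" "p' \<in> Hom ?F B' C'"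
        "a \<in> Hom ?F (Dom ?F i) A'" "b \<in> Hom ?F (Cod ?F i) B'" "c \<in> Hom ?F (Cod ?F p) C'"
        "is_iso ?F a" "is_iso ?F b" "is_iso ?F c"
        "b \<cdot>\<^bsub>?F\<^esub> i = i' \<cdot>\<^bsub>?F\<^esub> a" "c \<cdot>\<^bsub>?F\<^esub> p = p' \<cdot>\<^bsub>?F\<^esub> b"
      for i p i' A' B' p' C' a b c
      using Confl_iso[of i p i' A' B' p' C' a b c] that that(7-9)[THEN full_exact_subcategory_is_iso]
      by (auto simp: Hom_iff in_Hom_iff)
    show "inflation ?F (Ident ?F X)" "deflation ?F (Ident ?F X)" if "X \<in> Obj ?F" for X
    proof -
      have X: "X \<in> F" "X \<in> Obj E" "Z \<in> Obj E" using that F Z by auto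
      show "inflation ?F (Ident ?F X)" unfolding inflation_def
        using zero_Confl(1)[OF Z(1) X(2)] X Z(2) by (intro exI[of _ "hom_zero E X Z"]) simp
      show "deflation ?F (Ident ?F X)" unfolding deflation_def
        using zero_Confl(2)[OF Z(1) X(2)] X Z(2) by (intro exI[of _ "hom_zero E Z X"]) simp
    qed
    show "inflation ?F (j \<cdot>\<^bsub>?F\<^esub> i)"
      if infl: "inflation ?F i" "inflation ?F j" "Cod ?F i = Dom ?F j" for i j
    proof -
      obtain p where p: "(i, p) \<in> Confl E" "Dom E i \<in> F" "Cod E p \<in> F"
        using infl(1) by (auto simp: inflation_def)
      obtain q where q: "(j, q) \<in> Confl E" "Cod E j \<in> F" "Cod E q \<in> F"
        using infl(2) by (auto simp: inflation_def)
      have ij: "Cod E i = Dom E j" using that(3) by simp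
      obtain r where r: "(j \<cdot> i, r) \<in> Confl E" "ses E (Cod E p) (Cod E r) (Cod E q)"
        using ses_comp_inflations[OF p(1) q(1) ij] .
      have "Cod E r \<in> F" using closed_under_extensionsD[OF ext r(2) p(3) q(3)] .
      then show ?thesis
        unfolding inflation_def using r(1) p q ij Confl_simps[OF p(1)] Confl_simps[OF q(1)]
        by (intro exI[of _ r]) simp
    qed
    show "deflation ?F (q \<cdot>\<^bsub>?F\<^esub> p)"
      if infl: "deflation ?F p" "deflation ?F q" "Cod ?F p = Dom ?F q" for p q
    proof -
      obtain k where k: "(k, p) \<in> Confl E" "Dom E k \<in> F" "Cod E k \<in> F"
        using infl(1) by (auto simp: deflation_def)
      obtain l where l: "(l, q) \<in> Confl E" "Dom E l \<in> F" "Cod E q \<in> F"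
        using infl(2) by (auto simp: deflation_def)
      have pq: "Cod E p = Dom E q" using that(3) by simp
      obtain m where m: "(m, q \<cdot> p) \<in> Confl E" "ses E (Dom E k) (Dom E m) (Dom E l)"
        using ses_comp_deflations[OF k(1) l(1) pq] .
      have "Dom E m \<in> F" using closed_under_extensionsD[OF ext m(2) k(2) l(2)] .
      then show ?thesis
        unfolding deflation_def
        using m(1) k l pq Confl_simps[OF k(1)] Confl_simps[OF l(1)] Confl_simps[OF m(1)]
        by (intro exI[of _ m]) simp
    qed
    show "\<exists>i' f'. is_pushout ?F i f i' f' \<and> inflation ?F i'"
      if infl: "inflation ?F i" "f \<in> Arr ?F" "Dom ?F f = Dom ?F i" for i f
    proof -
      obtain p where p: "(i, p) \<in> Confl E" "Dom E i \<in> F" "Cod E i \<in> F" "Cod E p \<in> F"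
        using infl(1) by (auto simp: inflation_def)
      have f: "f \<in> Arr E" "Dom E f = Dom E i" "Cod E f \<in> F" using that by simp_all
      obtain i' f' where po: "is_pushout E i f i' f'"
        using inflation_pushout[of i f] p f by (auto simp: inflation_def)
      obtain p' where p': "(i', p') \<in> Confl E" "Cod E p' = Cod E p"
        using pushout_Confl[OF po p(1)] by metis
      have "Dom E i' = Cod E f" using is_pushoutD[OF po] by simp
      then have "Cod E i' \<in> F"
        using closed_under_extensionsD[OF ext Confl_ses[OF p'(1)]] p' p f by simp
      then have "is_pushout ?F i f i' f'" "(i', p') \<in> Confl ?F"
        using full_exact_subcategory_is_pushout[OF po] p p' f \<open>Dom E i' = Cod E f\<close> by simp_all
      then show ?thesis unfolding inflation_def by blast
    qed
    show "\<exists>p' f'. is_pullback ?F p f p' f' \<and> deflation ?F p'"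
      if infl: "deflation ?F p" "f \<in> Arr ?F" "Cod ?F f = Cod ?F p" for p f
    proof -
      obtain i where i: "(i, p) \<in> Confl E" "Dom E i \<in> F" "Cod E i \<in> F" "Cod E p \<in> F"
        using infl(1) by (auto simp: deflation_def)
      have f: "f \<in> Arr E" "Cod E f = Cod E p" "Dom E f \<in> F" using that by simp_all
      obtain p' f' where pb: "is_pullback E p f p' f'"
        using deflation_pullback[of p f] i f by (auto simp: deflation_def)
      obtain i' where i': "(i', p') \<in> Confl E" "Dom E i' = Dom E i"
        using pullback_Confl[OF pb i(1)] by metis
      have cod: "Cod E p' = Dom E f" using is_pullbackD[OF pb] by simp
      then have "Cod E i' \<in> F"
        using closed_under_extensionsD[OF ext Confl_ses[OF i'(1)]] i' i f by simp
      moreover have "Dom E p' = Cod E i'" "Dom E p = Cod E i"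
        using Confl_simps[OF i'(1)] Confl_simps[OF i(1)] by simp_all
      ultimately have "is_pullback ?F p f p' f'" "(i', p') \<in> Confl ?F"
        using full_exact_subcategory_is_pullback[OF pb] i i' f cod by simp_all
      then show ?thesis unfolding deflation_def by blast
    qed
  qed
qed

text \<open>\<open>X\<close> is a biproduct of \<open>Y\<close> with a zero object; closure under
  summands therefore yields closure under isomorphisms.\<close>

lemma isomorphic_direct_summand:
  assumes "isomorphic E X Y"
  shows "direct_summand E Y X"
proof -
  obtain f g where f: "f \<in> Arr E" "Dom E f = X" "Cod E f = Y" "g \<in> Arr E" "Dom E g = Y" "Cod E g = X"
    "g \<cdot> f = Ident E X" "f \<cdot> g = Ident E Y"
    using assms unfolding isomorphic_def is_iso_def by (auto simp: in_Hom_iff)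
  then have Obj: "X \<in> Obj E" "Y \<in> Obj E" by auto
  obtain Z where Z: "is_zero_object E Z" using zero_object_exists by blast
  then have ZO: "Z \<in> Obj E" by (simp add: is_zero_object_def)
  have "Ident E Z = hom_zero E Z Z"
    using zero_object_Hom(1)[OF Z, of "Ident E Z" Z] ZO by (simp add: in_Hom_iff)
  then have "is_biproduct E Y Z X"
    unfolding is_biproduct_def using f Obj ZO
    by (intro bexI[of _ g] bexI[of _ "hom_zero E Z X"] bexI[of _ f] bexI[of _ "hom_zero E X Z"])
       (simp_all add: in_Hom_iff)
  then show ?thesis unfolding direct_summand_def using Obj ZO by blast
qed

text \<open>A monomorphism is a kernel of some \<open>p\<close>, which need not be its cokernel.
  Passing to the cokernel \<open>q\<close> keeps the kernel, because \<open>p\<close> factors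
  through \<open>q\<close>.\<close>

lemma abelian_mono_inflation:
  assumes "abelian_category E" "standard_exact_structure E" "is_mono E f"
  shows "inflation E f"
proof -
  interpret ab: abelian_category E by fact
  obtain p where p: "is_kernel E f p" using ab.mono_is_kernel[OF assms(3)] by blast
  note P = is_kernelD[OF p]
  obtain q where q: "is_cokernel E q f" using ab.cokernel_exists[OF P(1)] by blast
  note Q = is_cokernelD[OF q]
  obtain r where r: "r \<in> Arr E" "Dom E r = Cod E q" "Cod E r = Cod E p" "r \<cdot> q = p"
    using is_cokernel_descE[OF q P(2) _ P(4)] P by metis
  have "is_kernel E f q"
  proof (rule is_kernelI)
    fix h assume h: "h \<in> Arr E" "Cod E h = Dom E q" "q \<cdot> h = hom_zero E (Dom E h) (Cod E q)"
    have "p \<cdot> h = r \<cdot> (q \<cdot> h)" using r Q h(1,2) Comp_assoc_Arr[of h q r] by simp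
    also have "\<dots> = hom_zero E (Dom E h) (Cod E p)" using h r by simp
    finally show "\<exists>k. k \<in> Arr E \<and> Dom E k = Dom E h \<and> Cod E k = Dom E f \<and> f \<cdot> k = h"
      using is_kernel_liftE[OF p h(1)] P Q h by metis
  next
    show "h = k" if "f \<cdot> h = f \<cdot> k" "h \<in> Arr E" "k \<in> Arr E" "Dom E h = Dom E k"
      "Cod E h = Dom E f" "Cod E k = Dom E f" for h k
      using is_kernel_cancel[OF p that] .
  qed (use Q in simp_all)
  then have "(f, q) \<in> Confl E"
    using assms(2) q by (simp add: standard_exact_structure_def kernel_cokernel_pair_def)
  then show ?thesis by (auto simp: inflation_def)
qed

end

section \<open>Transfer of the closure properties to \<open>Fddell\<close>\<close>

context exact_category_with_syzygies
begin

lemma Fddell_subset: "Fddell E S \<subseteq> Obj E"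
  by (auto simp: Fddell_def)

lemma Fddell_ses_subobject: "ses E X Y Q \<Longrightarrow> Y \<in> Fddell E S \<Longrightarrow> X \<in> Fddell E S"
  unfolding Fddell_iff by (rule finite_ddell_subobject)

lemma Fddell_inflation:
  assumes "inflation E i" "Cod E i \<in> Fddell E S"
  shows "Dom E i \<in> Fddell E S"
proof -
  obtain p where "(i, p) \<in> Confl E" using assms(1) by (auto simp: inflation_def)
  from Fddell_ses_subobject[OF Confl_ses[OF this] assms(2)] show ?thesis .
qed

lemma Fddell_projective: "projective E P \<Longrightarrow> P \<in> Fddell E S"
  unfolding Fddell_iff by (rule finite_ddell_projective)

lemma Fddell_extensions: "closed_under_extensions E (Fddell E S)"
  unfolding closed_under_extensions_def Fddell_iff
  using finite_ddell_extension Confl_ses by blast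

lemma Fddell_summands: "closed_under_summands E (Fddell E S)"
  unfolding closed_under_summands_def direct_summand_def
  using biproduct_ses Fddell_ses_subobject by blast

lemma Fddell_isos: "closed_under_isos E (Fddell E S)"
  using Fddell_summands isomorphic_direct_summand
  unfolding closed_under_isos_def closed_under_summands_def by blast

lemma Fddell_exact_category: "exact_category (full_exact_subcategory E (Fddell E S))"
proof -
  obtain Z where Z: "is_zero_object E Z" using zero_object_exists by blast
  show ?thesis
    using exact_full_exact_subcategory[OF Fddell_subset Fddell_extensions Z]
      Fddell_projective[OF zero_object_projective[OF Z]] .
qed

text \<open>The projective chosen over \<open>X\<close> in \<open>E\<close> serves again: it lies in
  the class, and so does its kernel as an admissible subobject of it, which makes the deflation one
  of the subcategory.\<close>

lemma Fddell_enough_projectives: "enough_projectives (full_exact_subcategory E (Fddell E S))"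
  unfolding enough_projectives_def
proof
  fix X assume "X \<in> Obj (full_exact_subcategory E (Fddell E S))"
  then have X: "X \<in> Fddell E S" "X \<in> Obj E" using Fddell_subset by auto
  obtain P where P: "projective E P" "ses E (syzygy E S X) P X" using syzygy_sesE[OF X(2)] .
  obtain i p where ip: "(i, p) \<in> Confl E" "Dom E i = syzygy E S X" "Cod E i = P" "Dom E p = P" "Cod E p = X"
    using P(2) by (auto elim: sesE)
  have PF: "P \<in> Fddell E S" by (rule Fddell_projective) fact
  \<comment> \<open>Deflations of the subcategory are deflations of \<open>E\<close>, so lifts exist
    in \<open>E\<close> and belong to the full subcategory.\<close>
  have "projective (full_exact_subcategory E (Fddell E S)) P"
    unfolding projective_def deflation_def Bex_def full_exact_subcategory_Hom
    using PF P(1) Confl_simps(3) unfolding projective_def deflation_def Bex_def 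
    by (auto simp: full_exact_subcategory_Hom) metis
  moreover have "syzygy E S X \<in> Fddell E S" by (rule Fddell_ses_subobject[OF P(2) PF])
  ultimately show "\<exists>p. deflation (full_exact_subcategory E (Fddell E S)) p \<and>
      Cod (full_exact_subcategory E (Fddell E S)) p = X \<and>
      projective (full_exact_subcategory E (Fddell E S)) (Dom (full_exact_subcategory E (Fddell E S)) p)"
    using ip X PF by (intro exI[of _ p]) (auto simp: deflation_def)
qed

end

theorem theorem3p8:
  fixes E :: "('o, 'm) exact_cat"
    and S :: "'o \<Rightarrow> 'm \<times> 'm"
  assumes "exact_category E"
    and "idempotent_complete E"
    and "enough_projectives E"
    and "syzygy_choice E S"
  shows "admissibly_torsion_free E (Fddell E S) \<and>
    resolving E (Fddell E S) \<and>
    exact_category (full_exact_subcategory E (Fddell E S)) \<and>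
    enough_projectives (full_exact_subcategory E (Fddell E S)) \<and>
    (length_abelian_category E \<and> standard_exact_structure E \<longrightarrow>
      torsion_free_class E (Fddell E S))"
proof -
  interpret exact_category_with_syzygies E S
    using assms(1,4) by (simp add: exact_category_with_syzygies_def exact_category_with_syzygies_axioms_def)
  have "admissibly_torsion_free E (Fddell E S)"
    unfolding admissibly_torsion_free_def
    using Fddell_subset Fddell_isos Fddell_summands Fddell_extensions Fddell_inflation by blast
  \<comment> \<open>The kernel of a deflation is an admissible subobject of the domain of the
    deflation, which gives the last condition.\<close>
  moreover have "resolving E (Fddell E S)"
    unfolding resolving_def
    using Fddell_subset Fddell_projective Fddell_extensions Fddell_summands
      Fddell_ses_subobject[OF Confl_ses] Confl_simps(3) by fastforce
  \<comment> \<open>In the standard structure every monomorphism is an inflation, so closure under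
    admissible subobjects becomes closure under subobjects.\<close>
  moreover have "torsion_free_class E (Fddell E S)"
    if "length_abelian_category E" "standard_exact_structure E"
    unfolding torsion_free_class_def
    using Fddell_subset Fddell_isos Fddell_extensions Fddell_inflation abelian_mono_inflation that
    unfolding length_abelian_category_def by blast
  ultimately show ?thesis using Fddell_exact_category Fddell_enough_projectives by blast
qed

end
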